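(* For every integer $N\ge1$ there exists a diagonal $\mathbb C^2$-action on some $\mathbb C^n$ whose weight configuration has uniform maximal rank and lies in the Poincaré domain, with the following properties: (i) the transverse analytic envelope at the origin is a point; (ii) along a one-dimensional singular orbit, the transverse analytic envelope has dimension $N$. For every $N\ge3$ the positive-dimensional envelope can be chosen singular at its distinguished point.
   Context: A diagonal $\mathbb C^k$-action on $\mathbb C^n$ is $t\cdot z=(e^{\Lambda_1(t)}z_1,\dots,e^{\Lambda_n(t)}z_n)$ with weights $\Lambda_1,\dots,\Lambda_n\in(\mathbb C^k)^*$ spanning $(\mathbb C^k)^*$; here $k=2$. The weights have uniform maximal rank if $\dim\operatorname{Span}\{\Lambda_i:i\in I\}=\min\{|I|,k\}$ for all $I$, and lie in the Poincaré domain if some $\xi\in\mathbb C^k$ has $\operatorname{Re}\Lambda_j(\xi)>0$ for all $j$. An orbit is singular if its dimension is $<k$. For a point with support $I=\{j:z_j\neq0\}$, put $\mathfrak h_I=\bigcap_{i\in I}\ker\Lambda_i$, $S_I=\{\alpha\in\mathbb N^{I^c}:\sum_{j\notin I}\alpha_j\Lambda_j|_{\mathfrak h_I}=0\}$ ($0\in\mathbb N$), $Q_I=\operatorname{Spec}\mathbb C[S_I]$. The transverse analytic envelope at that point is $(\mathbb C^{|I|-r_I},0)\times Q_I$ with $r_I=\dim\operatorname{Span}\{\Lambda_i:i\in I\}$; under uniform maximal rank and for singular orbits it equals $Q_I$. The distinguished point of $Q_I$ is the torus-fixed point $o_I$, the image of $0\in\mathbb C^{I^c}$, where all $X^\alpha$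 with $\alpha\in S_I\setminus\{0\}$ vanish. *)

theory Defs
  imports
    "HOL-Analysis.Analysis"
    "HOL-Library.Function_Algebras"
    "HOL-Library.Poly_Mapping"
    "HOL-Library.Extended_Nat"
    "HOL-Computational_Algebra.Fraction_Field"
    "HOL-Algebra.Ring_Divisibility"
begin

section \<open>Diagonal actions\<close>

text \<open>
  A weight configuration is a family \<open>\<Lambda> 0, \<dots>, \<Lambda> (n - 1)\<close>; the values at indices \<open>\<ge> n\<close> are irrelevant.
  A linear functional on \<open>\<complex>^k\<close> is given by its vector of coordinates in the dual basis, so it
  is evaluated at \<open>t\<close> by \<^const>\<open>scalar_product\<close> (bilinear, without complex conjugation).
  Points of \<open>\<complex>^n\<close> are functions on \<open>nat\<close> that vanish from \<open>n\<close> on.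
\<close>

definition affine_space :: "nat \<Rightarrow> (nat \<Rightarrow> complex) set" where
  "affine_space n = {z. \<forall>j\<ge>n. z j = 0}"

definition act :: "(nat \<Rightarrow> complex ^ 'k) \<Rightarrow> complex ^ 'k \<Rightarrow> (nat \<Rightarrow> complex) \<Rightarrow> (nat \<Rightarrow> complex)" where
  "act \<Lambda> t z = (\<lambda>j. exp (scalar_product (\<Lambda> j) t) * z j)"

definition diagonal_weights :: "nat \<Rightarrow> (nat \<Rightarrow> complex ^ 'k) \<Rightarrow> bool" where
  "diagonal_weights n \<Lambda> \<longleftrightarrow> vec.span (\<Lambda> ` {..<n}) = UNIV"

definition weight_rank :: "(nat \<Rightarrow> complex ^ 'k) \<Rightarrow> nat set \<Rightarrow> nat" where
  "weight_rank \<Lambda> I = vec.dim (vec.span (\<Lambda> ` I))"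

definition uniform_maximal_rank :: "nat \<Rightarrow> (nat \<Rightarrow> complex ^ 'k) \<Rightarrow> bool" where
  "uniform_maximal_rank n \<Lambda> \<longleftrightarrow>
     (\<forall>I\<subseteq>{..<n}. weight_rank \<Lambda> I = min (card I) CARD('k))"

definition poincare_domain :: "nat \<Rightarrow> (nat \<Rightarrow> complex ^ 'k) \<Rightarrow> bool" where
  "poincare_domain n \<Lambda> \<longleftrightarrow> (\<exists>\<xi>. \<forall>j<n. Re (scalar_product (\<Lambda> j) \<xi>) > 0)"

definition orbit :: "(nat \<Rightarrow> complex ^ 'k) \<Rightarrow> (nat \<Rightarrow> complex) \<Rightarrow> (nat \<Rightarrow> complex) set" where
  "orbit \<Lambda> z = range (\<lambda>t. act \<Lambda> t z)"

text \<open>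
  The orbit through \<open>z\<close> is an immersed complex submanifold whose tangent space at \<open>z\<close> consists of the
  velocities at time \<open>0\<close> of the one-parameter flows \<open>s \<mapsto> (s t) \<sqdot> z\<close>.  The
  dimension of the orbit is the complex dimension of this space.
\<close>

definition orbit_tangent_space :: "(nat \<Rightarrow> complex ^ 'k) \<Rightarrow> (nat \<Rightarrow> complex) \<Rightarrow> (nat \<Rightarrow> complex) set" where
  "orbit_tangent_space \<Lambda> z = range (\<lambda>t j. deriv (\<lambda>s. act \<Lambda> (s *s t) z j) 0)"

lemma orbit_tangent_space_eq:
  "orbit_tangent_space \<Lambda> z = range (\<lambda>t j. scalar_product (\<Lambda> j) t * z j)"
proof -
  have "deriv (\<lambda>s. act \<Lambda> (s *s t) z j) 0 = scalar_product (\<Lambda> j) t * z j" for t j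
  proof (rule DERIV_imp_deriv)
    have eq: "act \<Lambda> (s *s t) z j = exp (s * scalar_product (\<Lambda> j) t) * z j" for s
      by (simp add: act_def scalar_product_def sum_distrib_left algebra_simps)
    show "((\<lambda>s. act \<Lambda> (s *s t) z j) has_field_derivative scalar_product (\<Lambda> j) t * z j) (at 0)"
      unfolding eq by (auto intro!: derivative_eq_intros)
  qed
  then show ?thesis
    by (simp add: orbit_tangent_space_def)
qed

definition orbit_dim :: "(nat \<Rightarrow> complex ^ 'k) \<Rightarrow> (nat \<Rightarrow> complex) \<Rightarrow> nat" where
  "orbit_dim \<Lambda> z = vector_space.dim (\<lambda>(c::complex) v j. c * v j) (orbit_tangent_space \<Lambda> z)"

definition singular_orbit :: "(nat \<Rightarrow> complex ^ 'k) \<Rightarrow> (nat \<Rightarrow> complex) \<Rightarrow> bool" where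
  "singular_orbit \<Lambda> z \<longleftrightarrow> orbit_dim \<Lambda> z < CARD('k)"

definition point_support :: "(nat \<Rightarrow> complex) \<Rightarrow> nat set" where
  "point_support z = {j. z j \<noteq> 0}"


section \<open>Affine toric varieties and local rings\<close>

text \<open>
  For a submonoid \<open>M\<close> of the finitely supported exponent vectors, \<open>\<complex>[M]\<close> is the
  subring of the polynomial ring in the variables \<open>X 0, X 1, \<dots>\<close> consisting of the polynomials all of
  whose exponents lie in \<open>M\<close>.
\<close>

type_synonym mpoly = "(nat \<Rightarrow>\<^sub>0 nat) \<Rightarrow>\<^sub>0 complex"

definition monoid_algebra :: "(nat \<Rightarrow>\<^sub>0 nat) set \<Rightarrow> mpoly ring" where
  "monoid_algebra M =
     \<lparr>carrier = {f. Poly_Mapping.keys f \<subseteq> M}, monoid.mult = (*), one = 1, zero = 0, add = (+)\<rparr>"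

lemma cring_monoid_algebra:
  assumes "0 \<in> M" "\<And>\<alpha> \<beta>. \<alpha> \<in> M \<Longrightarrow> \<beta> \<in> M \<Longrightarrow> \<alpha> + \<beta> \<in> M"
  shows "cring (monoid_algebra M)"
proof -
  have mult: "Poly_Mapping.keys (f * g) \<subseteq> M"
    if "Poly_Mapping.keys f \<subseteq> M" "Poly_Mapping.keys g \<subseteq> M" for f g :: mpoly
    using keys_mult[of f g] that assms(2) by blast
  have add: "Poly_Mapping.keys (f + g) \<subseteq> M"
    if "Poly_Mapping.keys f \<subseteq> M" "Poly_Mapping.keys g \<subseteq> M" for f g :: mpoly
    using Poly_Mapping.keys_add[of f g] that by blast
  show ?thesis
  proof (rule cringI)
    show "abelian_group (monoid_algebra M)"
    proof (rule abelian_groupI)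
      fix f assume f: "f \<in> carrier (monoid_algebra M)"
      show "\<exists>g\<in>carrier (monoid_algebra M). g \<oplus>\<^bsub>monoid_algebra M\<^esub> f = \<zero>\<^bsub>monoid_algebra M\<^esub>"
        using f by (intro bexI[of _ "- f"]) (auto simp: monoid_algebra_def)
    qed (auto simp: monoid_algebra_def add.assoc add.commute dest: subsetD[OF add])
    show "Group.comm_monoid (monoid_algebra M)"
      by (rule comm_monoidI)
        (auto simp: monoid_algebra_def mult.assoc mult.commute assms(1) dest: subsetD[OF mult])
  qed (auto simp: monoid_algebra_def distrib_right)
qed

text \<open>\<open>Spec \<complex>[M]\<close> is a point if \<open>\<complex> \<rightarrow> \<complex>[M]\<close> is an isomorphism.\<close>

definition spec_is_point :: "(nat \<Rightarrow>\<^sub>0 nat) set \<Rightarrow> bool" where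
  "spec_is_point M \<longleftrightarrow>
     bij_betw (\<lambda>c. Poly_Mapping.single 0 c) UNIV (carrier (monoid_algebra M))"

definition krull_dim :: "('a, 'b) ring_scheme \<Rightarrow> enat" where
  "krull_dim R = Sup {enat m | m. \<exists>P :: nat \<Rightarrow> 'a set.
     (\<forall>i\<le>m. primeideal (P i) R) \<and> (\<forall>i<m. P i \<subset> P (Suc i))}"

definition regular_local_ring :: "('a, 'b) ring_scheme \<Rightarrow> bool" where
  "regular_local_ring R \<longleftrightarrow> cring R \<and> noetherian_ring R \<and>
     (\<exists>!\<mm>. maximalideal \<mm> R) \<and>
     (\<exists>X \<subseteq> carrier R. finite X \<and> enat (card X) = krull_dim R \<and>
        maximalideal (genideal R X) R)"

text \<open>
  At the distinguished point every \<open>X\<^sup>\<alpha>\<close> with \<open>\<alpha> \<in> M - {0}\<close> vanishes, so the value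
  of \<open>f\<close> there is its constant coefficient.  Since \<open>\<complex>[M]\<close> is a domain, its localization at the
  corresponding maximal ideal is the ring of those fractions whose denominator does not vanish there.
\<close>

definition distinguished_local_ring :: "(nat \<Rightarrow>\<^sub>0 nat) set \<Rightarrow> mpoly fract ring" where
  "distinguished_local_ring M =
     \<lparr>carrier = {Fract f g | f g. f \<in> carrier (monoid_algebra M) \<and> g \<in> carrier (monoid_algebra M) \<and>
                   Poly_Mapping.lookup g 0 \<noteq> 0},
      monoid.mult = (*), one = 1, zero = 0, add = (+)\<rparr>"

lemma cring_distinguished_local_ring:
  assumes "0 \<in> M" "\<And>\<alpha> \<beta>. \<alpha> \<in> M \<Longrightarrow> \<beta> \<in> M \<Longrightarrow> \<alpha> + \<beta> \<in> M"
  shows "cring (distinguished_local_ring M)"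
proof -
  let ?A = "{f :: mpoly. Poly_Mapping.keys f \<subseteq> M}"
  let ?L = "{Fract f g | f g. f \<in> ?A \<and> g \<in> ?A \<and> Poly_Mapping.lookup g 0 \<noteq> 0}"
  have carr: "carrier (distinguished_local_ring M) = ?L"
    by (auto simp: distinguished_local_ring_def monoid_algebra_def)
  interpret A: cring "monoid_algebra M" by (rule cring_monoid_algebra) (use assms in auto)
  have mult: "f * g \<in> ?A" if "f \<in> ?A" "g \<in> ?A" for f g
    using A.m_closed[of f g] that by (simp add: monoid_algebra_def)
  have add: "f + g \<in> ?A" if "f \<in> ?A" "g \<in> ?A" for f g
    using A.add.m_closed[of f g] that by (simp add: monoid_algebra_def)
  have lookup0: "Poly_Mapping.lookup (f * g) 0 = Poly_Mapping.lookup f 0 * Poly_Mapping.lookup g 0"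
    for f g :: mpoly
  proof -
    have eq: "(0 = k + q) = (k = 0 \<and> q = 0)" for k q :: "nat \<Rightarrow>\<^sub>0 nat"
      by (auto simp: poly_mapping_eq_iff lookup_add fun_eq_iff)
    have "(\<Sum>q. Poly_Mapping.lookup g q when 0 = k + q) =
                 (Poly_Mapping.lookup g 0 when k = 0)" for k :: "nat \<Rightarrow>\<^sub>0 nat"
      unfolding eq by (cases "k = 0") simp_all
    then show ?thesis
      by (simp add: lookup_mult mult_when)
  qed
  have Lin: "Fract f g \<in> ?L" if "f \<in> ?A" "g \<in> ?A" "Poly_Mapping.lookup g 0 \<noteq> 0" for f g
    using that by blast
  have Lmult: "x * y \<in> ?L" if xy: "x \<in> ?L" "y \<in> ?L" for x y
  proof -
    obtain f g f' g' where *: "x = Fract f g" "y = Fract f' g'" "f \<in> ?A" "g \<in> ?A" "f' \<in> ?A" "g' \<in> ?A"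
      "Poly_Mapping.lookup g 0 \<noteq> 0" "Poly_Mapping.lookup g' 0 \<noteq> 0"
      using xy by auto
    have "x * y = Fract (f * f') (g * g')" by (simp add: *)
    then show ?thesis
      using Lin[OF mult[OF *(3,5)] mult[OF *(4,6)]] *(7,8) lookup0[of g g'] by simp
  qed
  have Ladd: "x + y \<in> ?L" if xy: "x \<in> ?L" "y \<in> ?L" for x y
  proof -
    obtain f g f' g' where *: "x = Fract f g" "y = Fract f' g'" "f \<in> ?A" "g \<in> ?A" "f' \<in> ?A" "g' \<in> ?A"
      "Poly_Mapping.lookup g 0 \<noteq> 0" "Poly_Mapping.lookup g' 0 \<noteq> 0"
      using xy by auto
    have "g \<noteq> 0" "g' \<noteq> 0" using *(7,8) by auto
    then have "x + y = Fract (f * g' + f' * g) (g * g')" by (simp add: *)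
    then show ?thesis
      using Lin[OF add[OF mult[OF *(3,6)] mult[OF *(5,4)]] mult[OF *(4,6)]] *(7,8) lookup0[of g g']
      by simp
  qed
  have const: "Fract (Poly_Mapping.single 0 c) 1 \<in> ?L" for c
    using assms(1) by (intro Lin) auto
  have L1: "1 \<in> ?L" using const[of 1] by (simp add: One_fract_def)
  have L0: "0 \<in> ?L" using const[of 0] by (simp add: Zero_fract_def)
  have m1: "- 1 \<in> ?L" using const[of "- 1"] by (simp add: One_fract_def single_uminus)
  show ?thesis
  proof (rule cringI)
    show "abelian_group (distinguished_local_ring M)"
    proof (rule abelian_groupI)
      fix x assume x: "x \<in> carrier (distinguished_local_ring M)"
      have "- x \<in> ?L" using Lmult[OF m1, of x] x carr by simp
      then show "\<exists>y\<in>carrier (distinguished_local_ring M).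
          y \<oplus>\<^bsub>distinguished_local_ring M\<^esub> x = \<zero>\<^bsub>distinguished_local_ring M\<^esub>"
        unfolding carr by (intro bexI[of _ "- x"]) (auto simp: distinguished_local_ring_def)
    qed (unfold carr, use Ladd L0 in \<open>simp_all add: distinguished_local_ring_def add.assoc add.commute\<close>)
    show "Group.comm_monoid (distinguished_local_ring M)"
      by (rule comm_monoidI; unfold carr)
        (use Lmult L1 in \<open>simp_all add: distinguished_local_ring_def mult.assoc mult.commute\<close>)
  qed (simp add: distinguished_local_ring_def distrib_right)
qed

definition singular_at_distinguished_point :: "(nat \<Rightarrow>\<^sub>0 nat) set \<Rightarrow> bool" where
  "singular_at_distinguished_point M \<longleftrightarrow> \<not> regular_local_ring (distinguished_local_ring M)"


section \<open>The transverse analytic envelope\<close>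

definition isotropy_algebra :: "(nat \<Rightarrow> complex ^ 'k) \<Rightarrow> nat set \<Rightarrow> (complex ^ 'k) set" where
  "isotropy_algebra \<Lambda> I = {t. \<forall>i\<in>I. scalar_product (\<Lambda> i) t = 0}"

definition resonance_monoid :: "nat \<Rightarrow> (nat \<Rightarrow> complex ^ 'k) \<Rightarrow> nat set \<Rightarrow> (nat \<Rightarrow>\<^sub>0 nat) set" where
  "resonance_monoid n \<Lambda> I =
     {\<alpha>. Poly_Mapping.keys \<alpha> \<subseteq> {..<n} - I \<and>
         (\<forall>t \<in> isotropy_algebra \<Lambda> I.
            (\<Sum>j\<in>{..<n} - I. of_nat (Poly_Mapping.lookup \<alpha> j) * scalar_product (\<Lambda> j) t) = 0)}"

text \<open>
  The envelope \<open>(\<complex>^d, 0) \<times> Q\<^sub>I\<close>, \<open>d = |I| - r\<^sub>I\<close>, is encoded by the exponent monoid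
  \<open>\<nat>^d \<times> S\<^sub>I\<close> of \<open>\<complex>^d \<times> Q\<^sub>I\<close>, where the coordinates of the factor \<open>\<complex>^d\<close> carry
  the indices \<open>n, \<dots>, n + d - 1\<close>.  Replacing \<open>\<complex>^d\<close> by its germ at \<open>0\<close> changes neither the
  dimension nor regularity at \<open>(0, o\<^sub>I)\<close>.  For singular orbits of configurations of uniform
  maximal rank \<open>d = 0\<close>, and the envelope is \<open>Q\<^sub>I\<close> itself.
\<close>

definition envelope_monoid :: "nat \<Rightarrow> (nat \<Rightarrow> complex ^ 'k) \<Rightarrow> nat set \<Rightarrow> (nat \<Rightarrow>\<^sub>0 nat) set" where
  "envelope_monoid n \<Lambda> I =
     {\<alpha> + \<beta> | \<alpha> \<beta>. \<alpha> \<in> resonance_monoid n \<Lambda> I \<and>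
        Poly_Mapping.keys \<beta> \<subseteq> {n..<n + (card I - weight_rank \<Lambda> I)}}"

lemma envelope_monoid_eq_resonance_monoid:
  fixes \<Lambda> :: "nat \<Rightarrow> complex ^ 'k"
  assumes "uniform_maximal_rank n \<Lambda>" "I \<subseteq> {..<n}" "weight_rank \<Lambda> I < CARD('k)"
  shows "envelope_monoid n \<Lambda> I = resonance_monoid n \<Lambda> I"
proof -
  have "weight_rank \<Lambda> I = min (card I) CARD('k)"
    using assms(1,2) by (simp add: uniform_maximal_rank_def)
  then have "card I - weight_rank \<Lambda> I = 0"
    using assms(3) by simp
  then show ?thesis
    by (simp add: envelope_monoid_def)
qed

definition transverse_envelope :: "nat \<Rightarrow> (nat \<Rightarrow> complex ^ 'k) \<Rightarrow> (nat \<Rightarrow> complex) \<Rightarrow> (nat \<Rightarrow>\<^sub>0 nat) set" where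
  "transverse_envelope n \<Lambda> z = envelope_monoid n \<Lambda> (point_support z)"

definition spec_dim :: "(nat \<Rightarrow>\<^sub>0 nat) set \<Rightarrow> enat" where
  "spec_dim M = krull_dim (monoid_algebra M)"

end

theory Submission
  imports Defs
begin

text \<open>
  Use the weights \<open>(1, 0), (1, 1), (2, 1), \<dots>, (N, 1), (1, -2)\<close>.  Along the axis of the first
  coordinate the isotropy algebra is the second factor of \<open>\<complex>\<^sup>2\<close>, so \<open>S\<^sub>I\<close> is the monoid of
  exponents of even total degree in \<open>N\<close> variables and \<open>Q\<^sub>I\<close> is the quotient of
  \<open>\<complex>\<^sup>N\<close> by \<open>\<plusminus>1\<close>; at the origin the Poincare condition excludes resonances.

  The Krull dimension is bounded below by the chain of primes attached to a flag of faces.  For the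
  upper bound, elements \<open>x\<^sub>i \<in> P\<^sub>i\<^sub>+\<^sub>1 - P\<^sub>i\<close> picked along a chain of primes are algebraically
  independent, while counting monomials of bounded degree shows that any \<open>N + 1\<close> elements are
  dependent.  Localization does not increase the dimension, and for \<open>N \<ge> 2\<close> there are more than \<open>N\<close>
  indecomposable exponents, whose monomials are independent in \<open>\<mm>/\<mm>\<^sup>2\<close>; so the local ring at
  the distinguished point is not regular.
\<close>

section \<open>Krull dimension of monoid algebras\<close>

text \<open>Gaussian elimination by induction on the equations: an equation that vanishes
  identically is dropped, any other one eliminates a pivot unknown. The lemma yields both the
  algebraic relation for the dimension bound and the functional separating ideals in the local
  ring.\<close>

lemma homogeneous_system_nontrivial_solution:
  fixes A :: "'i \<Rightarrow> 'j \<Rightarrow> 'a::field"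
  assumes "finite E" "finite G" "card E < card G"
  shows "\<exists>c. (\<exists>g\<in>G. c g \<noteq> 0) \<and> (\<forall>e\<in>E. (\<Sum>g\<in>G. c g * A g e) = 0)"
  using assms
proof (induction E arbitrary: G A rule: finite_induct)
  case empty
  then have "G \<noteq> {}" by auto
  then show ?case by (intro exI[of _ "\<lambda>_. 1"]) auto
next
  case (insert e E)
  show ?case
  proof (cases "\<forall>g\<in>G. A g e = 0")
    case True
    have "card E < card G" using insert by simp
    from insert.IH[OF insert.prems(1) this, of A] True show ?thesis by auto
  next
    case False
    then obtain p where p: "p \<in> G" "A p e \<noteq> 0" by auto
    let ?G = "G - {p}"
    let ?B = "\<lambda>g d. A g d - A g e / A p e * A p d"
    have "card E < card ?G" using insert p by simp
    from insert.IH[OF _ this, of ?B] insert.prems(1) obtain c q where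
      q: "q \<in> ?G" "c q \<noteq> 0" and c: "\<And>d. d \<in> E \<Longrightarrow> (\<Sum>g\<in>?G. c g * ?B g d) = 0"
      by auto
    \<comment> \<open>Equation \<open>e\<close>, solved for the pivot unknown \<open>p\<close>,
      forces the value \<open>- s\<close>.\<close>
    define s where "s = (\<Sum>g\<in>?G. c g * (A g e / A p e))"
    define c' where "c' = c(p := - s)"
    have split: "(\<Sum>g\<in>G. c' g * A g d) = (\<Sum>g\<in>?G. c g * A g d) - s * A p d" for d
      using insert.prems(1) p(1)
      by (subst sum.remove[of _ p]) (auto simp: c'_def intro!: sum.cong)
    have "(\<Sum>g\<in>G. c' g * A g d) = 0" if "d \<in> insert e E" for d
    proof (cases "d = e")
      case True
      then show ?thesis
        using p(2) by (simp add: split s_def sum_distrib_right)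
    next
      case False
      have "(\<Sum>g\<in>?G. c g * ?B g d) = (\<Sum>g\<in>?G. c g * A g d) - s * A p d"
        by (simp add: s_def sum_distrib_right sum_subtractf right_diff_distrib mult.assoc)
      then show ?thesis using c[of d] that False by (simp add: split)
    qed
    moreover have "c' q \<noteq> 0" "q \<in> G" using q by (auto simp: c'_def)
    ultimately show ?thesis by blast
  qed
qed

section \<open>Monoid algebras and chains of primes\<close>

locale exponent_monoid =
  fixes M :: "(nat \<Rightarrow>\<^sub>0 nat) set"
  assumes zero_closed: "0 \<in> M"
    and add_closed: "\<alpha> \<in> M \<Longrightarrow> \<beta> \<in> M \<Longrightarrow> \<alpha> + \<beta> \<in> M"
begin

sublocale R: cring "monoid_algebra M"
  by (rule cring_monoid_algebra) (auto intro: zero_closed add_closed)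

lemma carrier_iff: "f \<in> carrier (monoid_algebra M) \<longleftrightarrow> Poly_Mapping.keys f \<subseteq> M"
  by (simp add: monoid_algebra_def)

lemma ring_ops [simp]:
  "f \<otimes>\<^bsub>monoid_algebra M\<^esub> g = f * g" "f \<oplus>\<^bsub>monoid_algebra M\<^esub> g = f + g"
  "\<one>\<^bsub>monoid_algebra M\<^esub> = 1" "\<zero>\<^bsub>monoid_algebra M\<^esub> = 0"
  by (simp_all add: monoid_algebra_def)

lemma carrier_closed:
  "0 \<in> carrier (monoid_algebra M)" "1 \<in> carrier (monoid_algebra M)"
  "f \<in> carrier (monoid_algebra M) \<Longrightarrow> g \<in> carrier (monoid_algebra M) \<Longrightarrow> f * g \<in> carrier (monoid_algebra M)"
  "f \<in> carrier (monoid_algebra M) \<Longrightarrow> g \<in> carrier (monoid_algebra M) \<Longrightarrow> f + g \<in> carrier (monoid_algebra M)"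
  "Poly_Mapping.single 0 c \<in> carrier (monoid_algebra M)"
  using R.zero_closed R.one_closed R.m_closed[of f g] R.a_closed[of f g] zero_closed
  by (simp_all add: carrier_iff)

lemma power_closed:
  "f \<in> carrier (monoid_algebra M) \<Longrightarrow> f ^ k \<in> carrier (monoid_algebra M)"
  by (induction k) (auto intro: carrier_closed)

lemma prod_closed:
  "(\<And>i. i \<in> S \<Longrightarrow> f i \<in> carrier (monoid_algebra M)) \<Longrightarrow> prod f S \<in> carrier (monoid_algebra M)"
  by (induction S rule: infinite_finite_induct) (auto intro: carrier_closed)

lemma sum_closed:
  "(\<And>i. i \<in> S \<Longrightarrow> f i \<in> carrier (monoid_algebra M)) \<Longrightarrow> sum f S \<in> carrier (monoid_algebra M)"
  by (induction S rule: infinite_finite_induct) (auto intro: carrier_closed)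

context
  fixes P :: "nat \<Rightarrow> mpoly set" and x :: "nat \<Rightarrow> mpoly" and m :: nat
  assumes prime: "\<And>i. i \<le> m \<Longrightarrow> primeideal (P i) (monoid_algebra M)"
    and chain: "\<And>i. i < m \<Longrightarrow> P i \<subseteq> P (Suc i)"
    and x: "\<And>i. i < m \<Longrightarrow> x i \<in> P (Suc i) - P i"
begin

text \<open>
  Among the monomials of a relation, those of least degree \<open>e\<close> in \<open>x k\<close> survive modulo
  \<open>P (Suc k)\<close> once \<open>x k ^ e\<close> is cancelled, so induction runs down the chain.
\<close>

lemma prime_chain_algebraically_independent:
  assumes "k \<le> m" "finite G" "G \<noteq> {}" "\<And>g. g \<in> G \<Longrightarrow> c g \<noteq> (0 :: complex)"
    and "\<And>g h. g \<in> G \<Longrightarrow> h \<in> G \<Longrightarrow> (\<And>i. i \<in> {k..<m} \<Longrightarrow> g i = h i) \<Longrightarrow> g = (h :: nat \<Rightarrow> nat)"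
  shows "(\<Sum>g\<in>G. Poly_Mapping.single 0 (c g) * (\<Prod>i\<in>{k..<m}. x i ^ g i)) \<notin> P k"
  using assms
proof (induction k arbitrary: G rule: inc_induct)
  case base
  \<comment> \<open>With no variables left, the separation hypothesis makes all elements of
    \<open>G\<close> equal. The sum is a single nonzero constant, hence a unit, and
    \<open>P m\<close> is proper.\<close>
  then obtain g where "G = {g}" by auto
  interpret pm: primeideal "P m" "monoid_algebra M" by (rule prime) simp
  have False if "Poly_Mapping.single 0 (c g) \<in> P m"
  proof -
    have "Poly_Mapping.single 0 (inverse (c g)) * Poly_Mapping.single 0 (c g) \<in> P m"
      using pm.I_l_closed[OF that carrier_closed(5)] by simp
    moreover have "c g \<noteq> 0" using \<open>G = {g}\<close> base by auto
    ultimately have "1 \<in> P m" by (simp add: mult_single)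
    then show False using pm.one_imp_carrier pm.I_notcarr by simp
  qed
  then show ?case using \<open>G = {g}\<close> by auto
next
  case (step k)
  define e where "e = Min ((\<lambda>g. g k) ` G)"
  define H where "H = {g \<in> G. g k = e}"
  have e_le: "e \<le> g k" if "g \<in> G" for g using that step.prems by (simp add: e_def)
  have "e \<in> (\<lambda>g. g k) ` G" unfolding e_def using step.prems by (intro Min_in) auto
  then have "H \<noteq> {}" by (auto simp: H_def)
  define T where "T = (\<lambda>g :: nat \<Rightarrow> nat. Poly_Mapping.single 0 (c g) * (\<Prod>i\<in>{Suc k..<m}. x i ^ g i))"
  define u where "u = (\<Sum>g\<in>H. T g)"
  \<comment> \<open>Outside \<open>H\<close> one has \<open>g k > e\<close>, so the truncated
    subtraction is exact there.\<close>
  define v where "v = (\<Sum>g\<in>G - H. x k ^ (g k - Suc e) * T g)"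
  interpret pk: primeideal "P k" "monoid_algebra M" by (rule prime) (use step in simp)
  interpret pk': primeideal "P (Suc k)" "monoid_algebra M" by (rule prime) (use step in simp)
  have xR: "x i \<in> carrier (monoid_algebra M)" if "i < m" for i
    using x[OF that] ideal.Icarr[OF primeideal.axioms(1)[OF prime[of "Suc i"]]] that by auto
  have TR: "T g \<in> carrier (monoid_algebra M)" for g
    unfolding T_def by (intro carrier_closed prod_closed power_closed xR) simp
  have uR: "u \<in> carrier (monoid_algebra M)"
    unfolding u_def by (intro sum_closed TR)
  have vR: "v \<in> carrier (monoid_algebra M)"
    unfolding v_def using step by (intro sum_closed carrier_closed(3) power_closed TR xR)
  have "u \<notin> P (Suc k)"
    unfolding u_def T_def
  proof (rule step.IH)
    fix g h assume gh: "g \<in> H" "h \<in> H" "\<And>i. i \<in> {Suc k..<m} \<Longrightarrow> g i = h i"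
    show "g = h"
    proof (rule step.prems(4))
      show "g i = h i" if "i \<in> {k..<m}" for i
        using that gh by (cases "i = k") (auto simp: H_def)
    qed (use gh in \<open>auto simp: H_def\<close>)
  qed (use step.prems \<open>H \<noteq> {}\<close> in \<open>auto simp: H_def\<close>)
  have eq: "Poly_Mapping.single 0 (c g) * (\<Prod>i\<in>{k..<m}. x i ^ g i) = x k ^ g k * T g" for g
    using step.hyps by (simp add: T_def prod.atLeast_Suc_lessThan)
  have "(\<Sum>g\<in>G. x k ^ g k * T g) = (\<Sum>g\<in>H. x k ^ g k * T g) + (\<Sum>g\<in>G - H. x k ^ g k * T g)"
    using step.prems by (subst sum.subset_diff[of H]) (auto simp: H_def)
  also have "(\<Sum>g\<in>H. x k ^ g k * T g) = x k ^ e * u"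
    by (simp add: u_def sum_distrib_left H_def)
  also have "(\<Sum>g\<in>G - H. x k ^ g k * T g) = x k ^ e * (x k * v)"
    unfolding v_def sum_distrib_left
  proof (rule sum.cong)
    fix g assume "g \<in> G - H"
    with e_le[of g] have "g k = e + Suc (g k - Suc e)" by (auto simp: H_def)
    then have "x k ^ g k = x k ^ e * (x k * x k ^ (g k - Suc e))"
      by (metis power_Suc power_add)
    then show "x k ^ g k * T g = x k ^ e * (x k * (x k ^ (g k - Suc e) * T g))"
      by (simp add: mult.assoc)
  qed simp
  finally have sum_eq: "(\<Sum>g\<in>G. x k ^ g k * T g) = x k ^ e * (u + x k * v)"
    by (simp add: distrib_left)
  have xk: "x k \<in> carrier (monoid_algebra M)" by (rule xR) (use step in simp)
  have wR: "u + x k * v \<in> carrier (monoid_algebra M)"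
    by (intro carrier_closed uR vR xk)
  \<comment> \<open>Powers of \<open>x k\<close> cancel modulo the prime \<open>P k\<close>, since
    \<open>x k\<close> lies outside it.\<close>
  have strip: "w \<in> P k" if "x k ^ r * w \<in> P k" "w \<in> carrier (monoid_algebra M)" for r w
    using that
  proof (induction r)
    case (Suc r)
    have "x k \<in> P k \<or> x k ^ r * w \<in> P k"
      using pk.I_prime[OF xk, of "x k ^ r * w"] Suc.prems carrier_closed(3)[OF power_closed[OF xk] Suc.prems(2)]
      by (simp add: mult.assoc)
    then show ?case using Suc x[of k] step.hyps by auto
  qed simp
  show ?case
    unfolding eq sum_eq
  proof
    assume "x k ^ e * (u + x k * v) \<in> P k"
    then have "u + x k * v \<in> P k" using strip wR by blast
    then have 1: "u + x k * v \<in> P (Suc k)" using chain[of k] step.hyps by auto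
    \<comment> \<open>\<open>x k\<close> belongs to the next prime, so only \<open>u\<close>
      survives modulo \<open>P (Suc k)\<close>, against the induction hypothesis.\<close>
    have "x k * v \<in> P (Suc k)"
      using pk'.I_r_closed[OF _ vR, of "x k"] x[of k] step.hyps by auto
    then have "- (x k * v) \<in> P (Suc k)"
      using pk'.I_l_closed[OF _ carrier_closed(5)[of "-1"], of "x k * v"]
      by (simp add: single_uminus)
    from pk'.a_closed[OF 1 this] have "u \<in> P (Suc k)" by simp
    with \<open>u \<notin> P (Suc k)\<close> show False ..
  qed
qed

end

end

section \<open>Upper bound for the Krull dimension by counting monomials\<close>

lemma krull_dim_geI:
  assumes "\<And>i. i \<le> m \<Longrightarrow> primeideal (P i) R" "\<And>i. i < m \<Longrightarrow> P i \<subset> P (Suc i)"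
  shows "enat m \<le> krull_dim R"
  unfolding krull_dim_def using assms by (intro Sup_upper) blast

lemma krull_dim_leI:
  assumes "\<And>m P. (\<And>i. i \<le> m \<Longrightarrow> primeideal (P i) R) \<Longrightarrow> (\<And>i. i < m \<Longrightarrow> P i \<subset> P (Suc i)) \<Longrightarrow> enat m \<le> d"
  shows "krull_dim R \<le> d"
  unfolding krull_dim_def using assms by (intro Sup_least) blast

lemma lookup_const_mult [simp]:
  "Poly_Mapping.lookup (Poly_Mapping.single 0 c * f) \<alpha> = c * Poly_Mapping.lookup (f :: mpoly) \<alpha>"
  by (simp flip: mult_map_scale_conv_mult add: map.rep_eq when_def)

text \<open>A degree bound taken coordinate by coordinate, so that the admissible exponents fill a
  box, and only over \<open>J\<close>, so that redundant coordinates do not enlarge the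
  count.\<close>

definition coordinates_le :: "nat set \<Rightarrow> nat \<Rightarrow> mpoly \<Rightarrow> bool" where
  "coordinates_le J a f \<longleftrightarrow> (\<forall>\<alpha>\<in>Poly_Mapping.keys f. \<forall>j\<in>J. Poly_Mapping.lookup \<alpha> j \<le> a)"

lemma coordinates_le_mono: "coordinates_le J a f \<Longrightarrow> a \<le> b \<Longrightarrow> coordinates_le J b f"
  by (force simp: coordinates_le_def)

lemma coordinates_le_mult:
  "coordinates_le J a f \<Longrightarrow> coordinates_le J b g \<Longrightarrow> coordinates_le J (a + b) (f * g)"
  using keys_mult[of f g] by (force simp: coordinates_le_def lookup_add intro: add_mono)

lemma coordinates_le_one: "coordinates_le J 0 1"
  by (simp add: coordinates_le_def)

lemma coordinates_le_power: "coordinates_le J a f \<Longrightarrow> coordinates_le J (k * a) (f ^ k)"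
  by (induction k) (auto intro: coordinates_le_mult coordinates_le_one)

lemma coordinates_le_prod:
  "(\<And>i. i \<in> S \<Longrightarrow> coordinates_le J (a i) (f i)) \<Longrightarrow> coordinates_le J (sum a S) (prod f S)"
  by (induction S rule: infinite_finite_induct) (auto intro: coordinates_le_mult coordinates_le_one)

lemma ex_coordinates_le:
  assumes "finite J"
  shows "\<exists>a. coordinates_le J a f"
proof -
  let ?V = "(\<lambda>(\<alpha>, j). Poly_Mapping.lookup \<alpha> j) ` (Poly_Mapping.keys f \<times> J)"
  have "finite ?V" using assms by simp
  then obtain a where "\<forall>v\<in>?V. v \<le> a" using finite_nat_set_iff_bounded_le by blast
  then show ?thesis by (auto simp: coordinates_le_def intro!: exI[of _ a])
qed

context exponent_monoid
begin

context
  fixes J :: "nat set"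
  assumes finite_J: "finite J"
    and J_determines: "\<And>\<alpha> \<beta>. \<alpha> \<in> M \<Longrightarrow> \<beta> \<in> M \<Longrightarrow>
      (\<And>j. j \<in> J \<Longrightarrow> Poly_Mapping.lookup \<alpha> j = Poly_Mapping.lookup \<beta> j) \<Longrightarrow> \<alpha> = \<beta>"
begin

text \<open>Restriction to \<open>J\<close> embeds \<open>E a\<close> into a box of side
  \<open>Suc a\<close>, because exponents in \<open>M\<close> are determined by their coordinates in
  \<open>J\<close>.\<close>

lemma bounded_exponents:
  defines "E \<equiv> \<lambda>a. {\<alpha> \<in> M. \<forall>j\<in>J. Poly_Mapping.lookup \<alpha> j \<le> a}"
  shows "finite (E a)" "card (E a) \<le> Suc a ^ card J"
proof -
  let ?r = "\<lambda>\<alpha>. restrict (Poly_Mapping.lookup \<alpha>) J"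
  have inj: "inj_on ?r (E a)"
    by (rule inj_onI, rule J_determines) (auto simp: E_def fun_eq_iff restrict_def split: if_splits)
  have sub: "?r ` E a \<subseteq> PiE J (\<lambda>_. {..a})"
    by (auto simp: E_def)
  have fin: "finite (PiE J (\<lambda>_. {..a}))" using finite_J by (auto intro: finite_PiE)
  show "finite (E a)" using inj sub fin by (meson finite_imageD finite_subset)
  show "card (E a) \<le> Suc a ^ card J"
    using card_inj_on_le[OF inj sub fin] finite_J by (simp add: card_PiE)
qed

text \<open>Products of the \<open>x i\<close> with exponents at most \<open>D\<close> number
  \<open>Suc D ^ m\<close>, whereas the exponents they involve grow only like
  \<open>D ^ card J\<close>. For \<open>m > card J\<close> the products outnumber these exponents
  when \<open>D\<close> is large.\<close>

lemma algebraically_dependent: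
  assumes x: "\<And>i. i < m \<Longrightarrow> x i \<in> carrier (monoid_algebra M)" and m: "card J < m"
  shows "\<exists>G c. finite G \<and> G \<noteq> {} \<and> (\<forall>g\<in>G. c g \<noteq> (0 :: complex)) \<and>
    G \<subseteq> PiE {0..<m} (\<lambda>_. UNIV :: nat set) \<and>
    (\<Sum>g\<in>G. Poly_Mapping.single 0 (c g) * (\<Prod>i\<in>{0..<m}. x i ^ g i)) = 0"
proof -
  have "\<forall>i. \<exists>a. coordinates_le J a (x i)" using ex_coordinates_le[OF finite_J] by blast
  then obtain b where b: "\<And>i. coordinates_le J (b i) (x i)" using choice by metis
  define B where "B = (\<Sum>i<m. b i)"
  have B: "coordinates_le J B (x i)" if "i < m" for i
    using that by (intro coordinates_le_mono[OF b]) (auto simp: B_def intro!: member_le_sum)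
  \<comment> \<open>The choice gives \<open>Suc (m * (D * B)) \<le> C * Suc D\<close>. With
    \<open>D = C ^ card J\<close> the constant \<open>C ^ card J\<close> is then absorbed by one
    more factor \<open>Suc D\<close>.\<close>
  define C where "C = Suc (m * B)"
  define D where "D = C ^ card J"
  define E where "E = {\<alpha> \<in> M. \<forall>j\<in>J. Poly_Mapping.lookup \<alpha> j \<le> m * (D * B)}"
  define F where "F = PiE {0..<m} (\<lambda>_. {..D})"
  let ?p = "\<lambda>g :: nat \<Rightarrow> nat. \<Prod>i\<in>{0..<m}. x i ^ g i"
  have finF: "finite F" by (auto simp: F_def intro: finite_PiE)
  have keys: "Poly_Mapping.keys (?p g) \<subseteq> E" if "g \<in> F" for g
  proof -
    have "coordinates_le J (\<Sum>i\<in>{0..<m}. g i * B) (?p g)"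
      using B by (intro coordinates_le_prod coordinates_le_power) auto
    moreover have "(\<Sum>i\<in>{0..<m}. g i * B) \<le> (\<Sum>i\<in>{0..<m}. D * B)"
      using that by (intro sum_mono mult_right_mono) (auto simp: F_def)
    ultimately have "coordinates_le J (m * (D * B)) (?p g)"
      by (auto intro: coordinates_le_mono)
    moreover have "?p g \<in> carrier (monoid_algebra M)"
      using x by (intro prod_closed power_closed) auto
    ultimately show ?thesis by (auto simp: E_def coordinates_le_def carrier_iff)
  qed
  have "card E \<le> Suc (m * (D * B)) ^ card J"
    unfolding E_def by (rule bounded_exponents)
  also have "\<dots> \<le> (C * Suc D) ^ card J"
    by (intro power_mono) (auto simp: C_def algebra_simps)
  also have "\<dots> = D * Suc D ^ card J"
    by (simp only: power_mult_distrib flip: D_def)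
  also have "\<dots> < Suc D ^ Suc (card J)" by simp
  also have "\<dots> \<le> Suc D ^ m" using m by (intro power_increasing) auto
  also have "\<dots> = card F" by (simp add: F_def card_PiE)
  finally have card: "card E < card F" .
  have finE: "finite E" unfolding E_def by (rule bounded_exponents)
  then obtain c h where h: "h \<in> F" "c h \<noteq> 0"
    and c: "\<And>\<alpha>. \<alpha> \<in> E \<Longrightarrow> (\<Sum>g\<in>F. c g * Poly_Mapping.lookup (?p g) \<alpha>) = 0"
    using homogeneous_system_nontrivial_solution[OF finE finF card, of "\<lambda>g. Poly_Mapping.lookup (?p g)"]
    by auto
  have "(\<Sum>g\<in>F. Poly_Mapping.single 0 (c g) * ?p g) = 0"
  proof (rule poly_mapping_eqI)
    fix \<alpha>
    have "(\<Sum>g\<in>F. c g * Poly_Mapping.lookup (?p g) \<alpha>) = 0"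
    proof (cases "\<alpha> \<in> E")
      case False
      then have "Poly_Mapping.lookup (?p g) \<alpha> = 0" if "g \<in> F" for g
        using keys[OF that] by (meson in_keys_iff subsetD)
      then show ?thesis by simp
    qed (rule c)
    then show "Poly_Mapping.lookup (\<Sum>g\<in>F. Poly_Mapping.single 0 (c g) * ?p g) \<alpha> = Poly_Mapping.lookup 0 \<alpha>"
      by (simp add: Poly_Mapping.lookup_sum)
  qed
  \<comment> \<open>Discarding the vanishing coefficients leaves a relation with nonzero ones only;
    \<open>h\<close> keeps it nonempty.\<close>
  moreover have "(\<Sum>g\<in>F. Poly_Mapping.single 0 (c g) * ?p g) =
    (\<Sum>g\<in>{g \<in> F. c g \<noteq> 0}. Poly_Mapping.single 0 (c g) * ?p g)"
    using finF by (intro sum.mono_neutral_right) auto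
  moreover have "F \<subseteq> PiE {0..<m} (\<lambda>_. UNIV)" unfolding F_def by (rule PiE_mono) simp
  ultimately show ?thesis
    using h finF by (intro exI[of _ "{g \<in> F. c g \<noteq> 0}"] exI[of _ c]) auto
qed

text \<open>A longer chain would provide more than \<open>card J\<close> elements
  \<open>x i\<close>. A relation among them equals \<open>0\<close>, which lies in
  \<open>P 0\<close>, while independence along the chain keeps the same sum out of
  \<open>P 0\<close>.\<close>

lemma krull_dim_monoid_algebra_le: "krull_dim (monoid_algebra M) \<le> enat (card J)"
proof (rule krull_dim_leI)
  fix k P
  assume P: "\<And>i. i \<le> k \<Longrightarrow> primeideal (P i) (monoid_algebra M)" "\<And>i. i < k \<Longrightarrow> P i \<subset> P (Suc i)"
  have "k \<le> card J"
  proof (rule ccontr)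
    assume k: "\<not> k \<le> card J"
    have "\<forall>i. \<exists>y. i < k \<longrightarrow> y \<in> P (Suc i) - P i" using P(2) by blast
    then obtain x where x: "\<And>i. i < k \<Longrightarrow> x i \<in> P (Suc i) - P i" by metis
    have xR: "x i \<in> carrier (monoid_algebra M)" if "i < k" for i
      using x[OF that] ideal.Icarr[OF primeideal.axioms(1)[OF P(1)[of "Suc i"]]] that by auto
    have cardk: "card J < k" using k by simp
    have "\<exists>G c. finite G \<and> G \<noteq> {} \<and> (\<forall>g\<in>G. c g \<noteq> (0 :: complex)) \<and>
      G \<subseteq> PiE {0..<k} (\<lambda>_. UNIV :: nat set) \<and>
      (\<Sum>g\<in>G. Poly_Mapping.single 0 (c g) * (\<Prod>i\<in>{0..<k}. x i ^ g i)) = 0"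
      by (rule algebraically_dependent[OF _ cardk]) (rule xR)
    then obtain G c where G: "finite G" "G \<noteq> {}" "\<forall>g\<in>G. c g \<noteq> (0 :: complex)"
      "G \<subseteq> PiE {0..<k} (\<lambda>_. UNIV :: nat set)"
      and zero: "(\<Sum>g\<in>G. Poly_Mapping.single 0 (c g) * (\<Prod>i\<in>{0..<k}. x i ^ g i)) = 0"
      by (elim exE conjE)
    have "(\<Sum>g\<in>G. Poly_Mapping.single 0 (c g) * (\<Prod>i\<in>{0..<k}. x i ^ g i)) \<notin> P 0"
    proof (rule prime_chain_algebraically_independent[where m = k])
      \<comment> \<open>Extensional functions agree outside \<open>{0..<k}\<close>, so their values
        inside separate them.\<close>
      show "g = h" if "g \<in> G" "h \<in> G" "\<And>i. i \<in> {0..<k} \<Longrightarrow> g i = h i" for g h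
        using that G(4) by (intro PiE_ext[of g "{0..<k}" "\<lambda>_. UNIV" h]) auto
    qed (use P x G in auto)
    moreover have "0 \<in> P 0"
      using additive_subgroup.zero_closed[OF ideal.axioms(1)[OF primeideal.axioms(1)[OF P(1)[of 0]]]]
      by simp
    ultimately show False using zero by simp
  qed
  then show "enat k \<le> enat (card J)" by simp
qed

end

end

section \<open>Ideals and the primes attached to faces\<close>

lemma (in cring) cring_idealI:
  assumes "I \<subseteq> carrier R" "\<zero> \<in> I" "\<And>a b. a \<in> I \<Longrightarrow> b \<in> I \<Longrightarrow> a \<oplus> b \<in> I"
    and mult: "\<And>a x. a \<in> I \<Longrightarrow> x \<in> carrier R \<Longrightarrow> x \<otimes> a \<in> I"
  shows "ideal I R"
proof (rule idealI)
  have "\<ominus> a \<in> I" if "a \<in> I" for a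
    using mult[OF that, of "\<ominus> \<one>"] that assms(1) by (auto simp: l_minus)
  then show "subgroup I (add_monoid R)"
    using assms by (intro add.subgroupI) (auto simp: a_inv_def)
  show "a \<otimes> x \<in> I" if "a \<in> I" "x \<in> carrier R" for a x
    using mult[OF that] m_comm[of a x] that assms(1) by auto
qed (use ring_axioms mult in auto)

text \<open>The constant coefficient is evaluation at the distinguished point; it is multiplicative
  because \<open>0\<close> splits only as \<open>0 + 0\<close> among exponents.\<close>

lemma lookup_zero_mult [simp]:
  "Poly_Mapping.lookup (f * g) 0 = Poly_Mapping.lookup f 0 * Poly_Mapping.lookup (g :: mpoly) 0"
proof -
  have "0 = k + q \<longleftrightarrow> k = 0 \<and> q = 0" for k q :: "nat \<Rightarrow>\<^sub>0 nat"
    by (auto simp: poly_mapping_eq_iff lookup_add fun_eq_iff)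
  then have "(\<Sum>q. Poly_Mapping.lookup g q when 0 = k + q) = (Poly_Mapping.lookup g 0 when k = 0)"
    for k :: "nat \<Rightarrow>\<^sub>0 nat"
    by (cases "k = 0") simp_all
  then show ?thesis by (simp add: lookup_mult mult_when)
qed

context exponent_monoid
begin

text \<open>The ideal is the kernel of truncation to the exponents in \<open>F\<close>. Truncated
  elements multiply inside the algebra of the face, which is a domain.\<close>

lemma primeideal_face:
  assumes F: "F \<subseteq> M" "0 \<in> F"
    and face: "\<And>\<alpha> \<beta>. \<alpha> \<in> M \<Longrightarrow> \<beta> \<in> M \<Longrightarrow> \<alpha> + \<beta> \<in> F \<longleftrightarrow> \<alpha> \<in> F \<and> \<beta> \<in> F"
  shows "primeideal {f. Poly_Mapping.keys f \<subseteq> M - F} (monoid_algebra M)" (is "primeideal ?P _")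
proof -
  have add: "f + g \<in> ?P" if "f \<in> ?P" "g \<in> ?P" for f g
    using that Poly_Mapping.keys_add[of f g] by blast
  have mult: "f * g \<in> ?P" if "g \<in> ?P" "f \<in> carrier (monoid_algebra M)" for f g
  proof -
    have "\<alpha> + \<beta> \<in> M - F" if "\<alpha> \<in> M" "\<beta> \<in> M - F" for \<alpha> \<beta>
      using that face[of \<alpha> \<beta>] add_closed[of \<alpha> \<beta>] by blast
    then show ?thesis using that keys_mult[of f g] unfolding carrier_iff by blast
  qed
  have diff: "f - g \<in> ?P" if "f \<in> ?P" "g \<in> ?P" for f g
    using that keys_diff[of f g] by blast
  have idl: "ideal ?P (monoid_algebra M)"
  proof (rule R.cring_idealI)
    show "?P \<subseteq> carrier (monoid_algebra M)" unfolding carrier_iff subset_iff by blast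
  qed (unfold ring_ops, use add mult in simp_all)
  have "f \<in> ?P \<or> g \<in> ?P"
    if fR: "f \<in> carrier (monoid_algebra M)" and gR: "g \<in> carrier (monoid_algebra M)" and fg: "f * g \<in> ?P" for f g
  proof -
    define r where "r = Poly_Mapping.mapp (\<lambda>\<alpha> (c :: complex). c when \<alpha> \<in> F)"
    have lookup_r: "Poly_Mapping.lookup (r h) \<alpha> = (Poly_Mapping.lookup h \<alpha> when \<alpha> \<in> F)" for h \<alpha>
      by (simp add: r_def lookup_mapp when_def in_keys_iff)
    have keys_r: "Poly_Mapping.keys (r h) = Poly_Mapping.keys h \<inter> F" for h
      by (auto simp: in_keys_iff lookup_r)
    have diff_r: "Poly_Mapping.keys (h - r h) = Poly_Mapping.keys h - F" for h
      by (auto simp: in_keys_iff lookup_r lookup_minus)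
    have rR: "r h \<in> carrier (monoid_algebra M)" for h
      using F by (auto simp: carrier_iff keys_r)
    have dP: "h - r h \<in> ?P" if "h \<in> carrier (monoid_algebra M)" for h
      using that by (auto simp: carrier_iff diff_r)
    \<comment> \<open>This expression expands to \<open>r f * r g\<close>, whose exponents all lie
      in \<open>F\<close>; membership in \<open>?P\<close> then makes it zero.\<close>
    have "f * g - g * (f - r f) - r f * (g - r g) \<in> ?P"
      by (intro diff fg mult dP fR gR rR)
    then have "r f * r g \<in> ?P" by (simp add: algebra_simps)
    moreover have "Poly_Mapping.keys (r f * r g) \<subseteq> F"
    proof -
      have "\<alpha> + \<beta> \<in> F" if "\<alpha> \<in> F" "\<beta> \<in> F" for \<alpha> \<beta>
        using that face[of \<alpha> \<beta>] F(1) by blast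
      then show ?thesis using keys_mult[of "r f" "r g"] unfolding keys_r by blast
    qed
    ultimately have "Poly_Mapping.keys (r f * r g) = {}" by blast
    then have "r f * r g = 0" by simp
    then have "r f = 0 \<or> r g = 0" by simp
    then show ?thesis using dP[OF fR] dP[OF gR] by fastforce
  qed
  moreover have "carrier (monoid_algebra M) \<noteq> ?P"
    using carrier_closed(2) F(2) by (auto dest!: equalityD1 simp: subset_iff)
  ultimately show ?thesis
    by (intro primeidealI[OF idl R.is_cring]) simp_all
qed

end

section \<open>The local ring at the distinguished point\<close>

context exponent_monoid
begin

abbreviation "L \<equiv> distinguished_local_ring M"

sublocale L: cring L
  by (rule cring_distinguished_local_ring) (auto intro: zero_closed add_closed)

lemma local_ring_ops [simp]:
  "f \<otimes>\<^bsub>L\<^esub> g = f * g" "f \<oplus>\<^bsub>L\<^esub> g = f + g" "\<one>\<^bsub>L\<^esub> = 1" "\<zero>\<^bsub>L\<^esub> = 0"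
  by (simp_all add: distinguished_local_ring_def)

lemma local_ring_carrier_iff:
  "x \<in> carrier L \<longleftrightarrow> (\<exists>f g. x = Fract f g \<and> f \<in> carrier (monoid_algebra M) \<and>
     g \<in> carrier (monoid_algebra M) \<and> Poly_Mapping.lookup g 0 \<noteq> 0)"
  by (auto simp: distinguished_local_ring_def)

text \<open>Primes of \<open>L\<close> contract to primes of the monoid algebra. Inclusions stay
  strict because denominators are units of \<open>L\<close>, so a fraction and its numerator lie in
  the same primes.\<close>

lemma krull_dim_local_ring_le: "krull_dim L \<le> krull_dim (monoid_algebra M)"
proof (rule krull_dim_leI)
  fix m P
  assume P: "\<And>i. i \<le> m \<Longrightarrow> primeideal (P i) L" "\<And>i. i < m \<Longrightarrow> P i \<subset> P (Suc i)"
  define Q where "Q = (\<lambda>i. {f \<in> carrier (monoid_algebra M). Fract f 1 \<in> P i})"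
  have inL: "Fract f 1 \<in> carrier L" if "f \<in> carrier (monoid_algebra M)" for f
    using that carrier_closed(2) unfolding local_ring_carrier_iff by (intro exI[of _ f] exI[of _ 1]) simp
  show "enat m \<le> krull_dim (monoid_algebra M)"
  proof (rule krull_dim_geI)
    fix i assume i: "i \<le> m"
    interpret Pi: primeideal "P i" L by (rule P(1)[OF i])
    show "primeideal (Q i) (monoid_algebra M)"
    proof (rule primeidealI)
      show "ideal (Q i) (monoid_algebra M)"
      proof (rule R.cring_idealI)
        show "\<zero>\<^bsub>monoid_algebra M\<^esub> \<in> Q i"
          using Pi.zero_closed carrier_closed(1) by (simp add: Q_def Zero_fract_def)
        show "a \<oplus>\<^bsub>monoid_algebra M\<^esub> b \<in> Q i" if "a \<in> Q i" "b \<in> Q i" for a b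
          using Pi.a_closed[of "Fract a 1" "Fract b 1"] that carrier_closed(4)[of a b]
          by (simp add: Q_def)
        show "f \<otimes>\<^bsub>monoid_algebra M\<^esub> a \<in> Q i" if "a \<in> Q i" "f \<in> carrier (monoid_algebra M)" for a f
          using Pi.I_l_closed[of "Fract a 1" "Fract f 1"] that carrier_closed(3)[of f a] inL[of f]
          by (simp add: Q_def)
      qed (auto simp: Q_def)
      show "carrier (monoid_algebra M) \<noteq> Q i"
        using Pi.one_imp_carrier Pi.I_notcarr carrier_closed(2)
        by (auto simp: Q_def One_fract_def)
      show "a \<in> Q i \<or> b \<in> Q i"
        if "a \<in> carrier (monoid_algebra M)" "b \<in> carrier (monoid_algebra M)" "a \<otimes>\<^bsub>monoid_algebra M\<^esub> b \<in> Q i" for a b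
        using Pi.I_prime[of "Fract a 1" "Fract b 1"] that inL[of a] inL[of b] by (auto simp: Q_def)
    qed (rule R.is_cring)
  next
    fix i assume i: "i < m"
    interpret P0: primeideal "P i" L by (rule P(1)) (use i in simp)
    interpret P1: primeideal "P (Suc i)" L by (rule P(1)) (use i in simp)
    obtain y where y: "y \<in> P (Suc i)" "y \<notin> P i" using P(2)[OF i] by blast
    then obtain f g where fg: "y = Fract f g" "f \<in> carrier (monoid_algebra M)"
      "g \<in> carrier (monoid_algebra M)" "Poly_Mapping.lookup g 0 \<noteq> 0"
      using P1.Icarr local_ring_carrier_iff by blast
    have "g \<noteq> 0" using fg(4) by auto
    have "Fract g 1 * y = Fract f 1"
      using \<open>g \<noteq> 0\<close> by (simp add: fg(1) eq_fract)
    then have "Fract f 1 \<in> P (Suc i)"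
      using P1.I_l_closed[OF y(1) inL[OF fg(3)]] by simp
    moreover have "Fract f 1 \<notin> P i"
    proof
      assume *: "Fract f 1 \<in> P i"
      have "Fract 1 g \<in> carrier L"
        using fg by (auto simp: local_ring_carrier_iff intro!: carrier_closed)
      then show False using P0.I_l_closed[OF *, of "Fract 1 g"] y(2) fg(1) by simp
    qed
    ultimately show "Q i \<subset> Q (Suc i)" using P(2)[OF i] fg(2) by (auto simp: Q_def)
  qed
qed

section \<open>Indecomposable exponents and the failure of regularity\<close>

definition indecomposable :: "(nat \<Rightarrow>\<^sub>0 nat) \<Rightarrow> bool" where
  "indecomposable \<alpha> \<longleftrightarrow> \<alpha> \<in> M \<and> \<alpha> \<noteq> 0 \<and> (\<forall>\<beta>\<in>M. \<forall>\<gamma>\<in>M. \<alpha> = \<beta> + \<gamma> \<longrightarrow> \<beta> = 0 \<or> \<gamma> = 0)"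

text \<open>This is the Leibniz rule at the distinguished point: once constant terms are removed, no
  product of two terms can have exponent \<open>\<alpha>\<close>.\<close>

lemma lookup_mult_indecomposable:
  assumes f: "f \<in> carrier (monoid_algebra M)" and g: "g \<in> carrier (monoid_algebra M)" and \<alpha>: "indecomposable \<alpha>"
  shows "Poly_Mapping.lookup (f * g) \<alpha> =
    Poly_Mapping.lookup f 0 * Poly_Mapping.lookup g \<alpha> + Poly_Mapping.lookup f \<alpha> * Poly_Mapping.lookup g 0"
proof -
  have \<alpha>0: "\<alpha> \<noteq> 0" using \<alpha> by (simp add: indecomposable_def)
  define f' where "f' = f - Poly_Mapping.single 0 (Poly_Mapping.lookup f 0)"
  define g' where "g' = g - Poly_Mapping.single 0 (Poly_Mapping.lookup g 0)"
  have k: "Poly_Mapping.keys f' \<subseteq> M - {0}" "Poly_Mapping.keys g' \<subseteq> M - {0}"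
    using f g by (auto simp: f'_def g'_def in_keys_iff lookup_minus lookup_single when_def carrier_iff split: if_splits)
  have "\<alpha> \<notin> Poly_Mapping.keys (f' * g')"
    using \<alpha> k keys_mult[of f' g'] unfolding indecomposable_def by blast
  then have "Poly_Mapping.lookup (f' * g') \<alpha> = 0" by (simp add: in_keys_iff)
  moreover have "f * g = f' * g' + Poly_Mapping.single 0 (Poly_Mapping.lookup f 0) * g
      + Poly_Mapping.single 0 (Poly_Mapping.lookup g 0) * f
      - Poly_Mapping.single 0 (Poly_Mapping.lookup f 0 * Poly_Mapping.lookup g 0)"
    by (simp add: f'_def g'_def algebra_simps mult_single)
  ultimately show ?thesis using \<alpha>0
    by (simp add: lookup_add lookup_minus lookup_single)
qed

text \<open>
  Fewer than \<open>card H\<close> elements of \<open>\<mm>\<close> are annihilated by a nonzero linear combination of the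
  coefficients at \<open>H\<close>.  These coefficients are derivations at the distinguished point, so the
  annihilated elements form an ideal \<open>I c\<close>, which is proper in \<open>\<mm> = I (\<lambda>_. 0)\<close>.
\<close>

theorem not_regular_local_ring:
  assumes H: "finite H" "\<And>\<alpha>. \<alpha> \<in> H \<Longrightarrow> indecomposable \<alpha>" "krull_dim L < enat (card H)"
  shows "\<not> regular_local_ring L"
proof
  assume "regular_local_ring L"
  then obtain X where X: "X \<subseteq> carrier L" "finite X" "enat (card X) = krull_dim L"
    and max: "maximalideal (genideal L X) L"
    by (auto simp: regular_local_ring_def)
  interpret m: maximalideal "genideal L X" L by (rule max)
  have one_notin: "1 \<notin> genideal L X" using m.one_imp_carrier m.I_notcarr by auto
  have "\<exists>f g. x = Fract f g \<and> f \<in> carrier (monoid_algebra M) \<and> g \<in> carrier (monoid_algebra M) \<and>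
      Poly_Mapping.lookup g 0 \<noteq> 0 \<and> Poly_Mapping.lookup f 0 = 0" if x: "x \<in> X" for x
  proof -
    have xI: "x \<in> genideal L X" using L.genideal_self[OF X(1)] x by auto
    obtain f g where fg: "x = Fract f g" "f \<in> carrier (monoid_algebra M)"
      "g \<in> carrier (monoid_algebra M)" "Poly_Mapping.lookup g 0 \<noteq> 0"
      using X(1) x local_ring_carrier_iff by blast
    have "Poly_Mapping.lookup f 0 = 0"
    proof (rule ccontr)
      \<comment> \<open>With this assumption \<open>x\<close> would be a unit inside a proper
        ideal.\<close>
      assume f0: "Poly_Mapping.lookup f 0 \<noteq> 0"
      then have "f \<noteq> 0" "g \<noteq> 0" using fg(4) by auto
      then have "Fract g f * x = 1" by (simp add: fg(1) One_fract_def eq_fract)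
      moreover have "Fract g f \<in> carrier L" using f0 fg by (auto simp: local_ring_carrier_iff)
      ultimately show False using m.I_l_closed[OF xI, of "Fract g f"] one_notin by simp
    qed
    then show ?thesis using fg by blast
  qed
  then obtain nm dn where nd: "\<And>x. x \<in> X \<Longrightarrow> x = Fract (nm x) (dn x) \<and> nm x \<in> carrier (monoid_algebra M) \<and>
      dn x \<in> carrier (monoid_algebra M) \<and> Poly_Mapping.lookup (dn x) 0 \<noteq> 0 \<and> Poly_Mapping.lookup (nm x) 0 = 0"
    by metis
  have "card X < card H" using X(3) H(3) by (metis enat_ord_simps(2))
  \<comment> \<open>There is one equation for each generator in \<open>X\<close> and one unknown for
    each exponent in \<open>H\<close>.\<close>
  from homogeneous_system_nontrivial_solution[OF X(2) H(1) this, of "\<lambda>\<alpha> x. Poly_Mapping.lookup (nm x) \<alpha>"]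
  obtain c \<alpha> where \<alpha>: "\<alpha> \<in> H" "c \<alpha> \<noteq> 0"
    and c: "\<And>x. x \<in> X \<Longrightarrow> (\<Sum>\<beta>\<in>H. c \<beta> * Poly_Mapping.lookup (nm x) \<beta>) = 0"
    by auto
  define I where "I = (\<lambda>c. {Fract f g | f g. f \<in> carrier (monoid_algebra M) \<and> g \<in> carrier (monoid_algebra M) \<and>
      Poly_Mapping.lookup g 0 \<noteq> 0 \<and> Poly_Mapping.lookup f 0 = 0 \<and>
      (\<Sum>\<beta>\<in>H. c \<beta> * Poly_Mapping.lookup f \<beta>) = 0})"
  have ideal_I: "ideal (I c) L" for c
  proof (rule L.cring_idealI)
    show "I c \<subseteq> carrier L"
      unfolding I_def subset_iff mem_Collect_eq local_ring_carrier_iff by blast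
    show "\<zero>\<^bsub>L\<^esub> \<in> I c"
      using carrier_closed(1,2) unfolding I_def mem_Collect_eq local_ring_ops Zero_fract_def
      by (intro exI[of _ 0] exI[of _ 1]) simp
    fix a x assume "a \<in> I c" "x \<in> carrier L"
    then obtain f g f' g' where a: "a = Fract f g" "f \<in> carrier (monoid_algebra M)"
      "g \<in> carrier (monoid_algebra M)" "Poly_Mapping.lookup g 0 \<noteq> 0" "Poly_Mapping.lookup f 0 = 0"
      "(\<Sum>\<beta>\<in>H. c \<beta> * Poly_Mapping.lookup f \<beta>) = 0"
      and x: "x = Fract f' g'" "f' \<in> carrier (monoid_algebra M)" "g' \<in> carrier (monoid_algebra M)"
      "Poly_Mapping.lookup g' 0 \<noteq> 0"
      unfolding I_def local_ring_carrier_iff by blast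
    \<comment> \<open>As \<open>f\<close> has no constant term, one half of the Leibniz rule drops
      out and the functional is only scaled by the constant term of \<open>f'\<close>.\<close>
    have "(\<Sum>\<beta>\<in>H. c \<beta> * Poly_Mapping.lookup (f' * f) \<beta>) =
        (\<Sum>\<beta>\<in>H. Poly_Mapping.lookup f' 0 * (c \<beta> * Poly_Mapping.lookup f \<beta>))"
      using H(2) a x by (intro sum.cong) (auto simp: lookup_mult_indecomposable)
    also have "\<dots> = 0" using a(6) by (simp flip: sum_distrib_left)
    finally show "x \<otimes>\<^bsub>L\<^esub> a \<in> I c"
      unfolding I_def mem_Collect_eq using a x
      by (intro exI[of _ "f' * f"] exI[of _ "g' * g"]) (simp add: carrier_closed)
  next
    fix a x assume "a \<in> I c" "x \<in> I c"
    then obtain f g f' g' where a: "a = Fract f g" "f \<in> carrier (monoid_algebra M)"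
      "g \<in> carrier (monoid_algebra M)" "Poly_Mapping.lookup g 0 \<noteq> 0" "Poly_Mapping.lookup f 0 = 0"
      "(\<Sum>\<beta>\<in>H. c \<beta> * Poly_Mapping.lookup f \<beta>) = 0"
      and x: "x = Fract f' g'" "f' \<in> carrier (monoid_algebra M)" "g' \<in> carrier (monoid_algebra M)"
      "Poly_Mapping.lookup g' 0 \<noteq> 0" "Poly_Mapping.lookup f' 0 = 0"
      "(\<Sum>\<beta>\<in>H. c \<beta> * Poly_Mapping.lookup f' \<beta>) = 0"
      unfolding I_def by blast
    have "g \<noteq> 0" "g' \<noteq> 0" using a(4) x(4) by auto
    then have sum: "a + x = Fract (f * g' + f' * g) (g * g')" by (simp add: a x)
    have "(\<Sum>\<beta>\<in>H. c \<beta> * Poly_Mapping.lookup (f * g' + f' * g) \<beta>) =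
        (\<Sum>\<beta>\<in>H. Poly_Mapping.lookup g' 0 * (c \<beta> * Poly_Mapping.lookup f \<beta>) +
          Poly_Mapping.lookup g 0 * (c \<beta> * Poly_Mapping.lookup f' \<beta>))"
      using H(2) a x by (intro sum.cong) (auto simp: lookup_add lookup_mult_indecomposable algebra_simps)
    also have "\<dots> = 0" using a(6) x(6) by (simp add: sum.distrib flip: sum_distrib_left)
    finally show "a \<oplus>\<^bsub>L\<^esub> x \<in> I c"
      unfolding I_def mem_Collect_eq local_ring_ops sum using a x
      by (intro exI[of _ "f * g' + f' * g"] exI[of _ "g * g'"]) (simp add: lookup_add carrier_closed)
  qed
  have "X \<subseteq> I c"
  proof
    fix x assume x: "x \<in> X"
    show "x \<in> I c"
      unfolding I_def using nd[OF x] c[OF x] by blast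
  qed
  then have "genideal L X \<subseteq> I c" by (rule L.genideal_minimal[OF ideal_I])
  also have I_sub: "I c \<subseteq> I (\<lambda>_. 0)" by (auto simp: I_def)
  finally have sub: "genideal L X \<subseteq> I (\<lambda>_. 0)" .
  have "1 \<notin> I (\<lambda>_. 0)"
  proof
    assume "1 \<in> I (\<lambda>_. 0)"
    then obtain f g :: mpoly where "Fract 1 1 = Fract f g" "Poly_Mapping.lookup g 0 \<noteq> 0" "Poly_Mapping.lookup f 0 = 0"
      unfolding I_def mem_Collect_eq One_fract_def by blast
    moreover from this have "g \<noteq> 0" by auto
    ultimately show False by (auto simp: eq_fract)
  qed
  then have "I (\<lambda>_. 0) \<noteq> carrier L" using L.one_closed by auto
  \<comment> \<open>Maximality leaves no room between the generated ideal and
    \<open>I (\<lambda>_. 0)\<close>, so \<open>I c\<close>, squeezed between them, coincides with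
    both.\<close>
  then have "I (\<lambda>_. 0) = genideal L X"
    using m.I_maximal[OF ideal_I sub] ideal.Icarr[OF ideal_I] by blast
  then have I_eq: "I (\<lambda>_. 0) = I c" using \<open>genideal L X \<subseteq> I c\<close> I_sub by auto
  have \<alpha>M: "\<alpha> \<in> M" "\<alpha> \<noteq> 0" using H(2)[OF \<alpha>(1)] by (auto simp: indecomposable_def)
  let ?X = "Poly_Mapping.single \<alpha> 1 :: mpoly"
  have XR: "?X \<in> carrier (monoid_algebra M)" using \<alpha>M by (simp add: carrier_iff)
  then have "Fract ?X 1 \<in> I (\<lambda>_. 0)"
    using \<alpha>M carrier_closed(2) unfolding I_def mem_Collect_eq
    by (intro exI[of _ ?X] exI[of _ 1]) (simp add: lookup_single)
  then obtain f g where fg: "Fract ?X 1 = Fract f g" "f \<in> carrier (monoid_algebra M)"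
      "g \<in> carrier (monoid_algebra M)" "Poly_Mapping.lookup g 0 \<noteq> 0"
      "(\<Sum>\<beta>\<in>H. c \<beta> * Poly_Mapping.lookup f \<beta>) = 0"
    unfolding I_eq unfolding I_def mem_Collect_eq by blast
  have "g \<noteq> 0" using fg(4) by auto
  \<comment> \<open>Membership in \<open>I c\<close> concerns some representation
    \<open>f / g\<close> of the monomial. Whichever it is, the functional takes the value
    \<open>c \<alpha>\<close> times the nonzero constant term of \<open>g\<close>.\<close>
  then have f: "f = ?X * g" using fg(1) by (simp add: eq_fract)
  have "(\<Sum>\<beta>\<in>H. c \<beta> * Poly_Mapping.lookup f \<beta>) = (\<Sum>\<beta>\<in>H. if \<beta> = \<alpha> then c \<alpha> * Poly_Mapping.lookup g 0 else 0)"
    using H(2) \<alpha>M by (intro sum.cong)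
      (auto simp: f lookup_mult_indecomposable[OF XR fg(3)] lookup_single when_def)
  also have "\<dots> = c \<alpha> * Poly_Mapping.lookup g 0" using \<alpha>(1) H(1) by simp
  finally show False using fg(4,5) \<alpha>(2) by simp
qed

end

section \<open>A Veronese envelope\<close>

text \<open>The second coordinates carry the resonance. The first ones are positive, for the
  Poincare condition, and equal to \<open>j\<close> for \<open>1 \<le> j \<le> N\<close>, which
  keeps those weights pairwise independent.\<close>

definition veronese_weights :: "nat \<Rightarrow> nat \<Rightarrow> complex ^ 2" where
  "veronese_weights N j =
     (if j = 0 then vector [1, 0] else if j \<le> N then vector [of_nat j, 1] else vector [1, - 2])"

lemma veronese_weights_nth:
  "veronese_weights N j $ 1 = (if j = 0 then 1 else if j \<le> N then of_nat j else 1)"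
  "veronese_weights N j $ 2 = (if j = 0 then 0 else if j \<le> N then 1 else - 2)"
  by (simp_all add: veronese_weights_def)

lemma scalar_product_2: "scalar_product a t = a $ 1 * t $ 1 + a $ 2 * t $ 2" for a t :: "complex ^ 2"
  by (simp add: scalar_product_def sum_2)

lemma veronese_weights_nonzero: "veronese_weights N i \<noteq> 0"
proof
  assume "veronese_weights N i = 0"
  then have "veronese_weights N i $ 1 = 0" by simp
  then show False by (simp add: veronese_weights_nth split: if_splits)
qed

lemma veronese_weights_det_nonzero:
  assumes "i \<noteq> j" "i < N + 2" "j < N + 2"
  shows "veronese_weights N i $ 1 * veronese_weights N j $ 2 \<noteq> veronese_weights N i $ 2 * veronese_weights N j $ 1"
proof -
  \<comment> \<open>Dependence of \<open>(k, 1)\<close> and \<open>(1, -2)\<close> would mean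
    \<open>- 2 * k = 1\<close>, impossible for a natural number.\<close>
  have nz: "- (of_nat k * (2 :: complex)) \<noteq> 1" "1 \<noteq> - (2 * (of_nat k :: complex))" for k
    by (auto simp: complex_eq_iff)
  show ?thesis
    using assms nz[of i] nz[of j]
    by (cases "i = 0"; cases "j = 0"; cases "i \<le> N"; cases "j \<le> N") (simp_all add: veronese_weights_nth)
qed

lemma vec2_independent_pair:
  fixes a b :: "'a::field ^ 2"
  assumes "a $ 1 * b $ 2 \<noteq> a $ 2 * b $ 1"
  shows "a \<noteq> b" "vec.independent {a, b}"
proof -
  show "a \<noteq> b" using assms by (auto simp: mult.commute)
  have "b \<noteq> 0" using assms by auto
  moreover have "a \<notin> vec.span {b}"
    using assms by (auto simp: vec.span_singleton)
  ultimately show "vec.independent {a, b}"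
    using \<open>a \<noteq> b\<close> by (simp add: vec.independent_insert)
qed

text \<open>Two distinct indices already give rank two, the maximum in the plane, so only index sets
  with fewer elements need separate treatment.\<close>

lemma uniform_maximal_rank_veronese_weights: "uniform_maximal_rank (N + 2) (veronese_weights N)"
  unfolding uniform_maximal_rank_def
proof (intro allI impI)
  fix I assume I: "I \<subseteq> {..<N + 2}"
  then have fin: "finite I" by (rule finite_subset) simp
  let ?S = "veronese_weights N ` I"
  consider "I = {}" | i where "I = {i}" | i j where "i \<in> I" "j \<in> I" "i \<noteq> j" by auto
  then show "weight_rank (veronese_weights N) I = min (card I) CARD(2)"
  proof cases
    case 1
    then show ?thesis by (simp add: weight_rank_def)
  next
    case (2 i)
    then show ?thesis by (simp add: weight_rank_def veronese_weights_nonzero)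
  next
    case (3 i j)
    note ind = vec2_independent_pair[OF veronese_weights_det_nonzero[of i j N]]
    have "card {veronese_weights N i, veronese_weights N j} \<le> vec.dim ?S"
      using 3 I by (intro vec.independent_card_le_dim ind(2)) auto
    moreover have "veronese_weights N i \<noteq> veronese_weights N j" using 3 I by (intro ind(1)) auto
    moreover have "vec.dim ?S \<le> 2" using dim_subset_UNIV_cart_gen[of ?S] by simp
    moreover have "2 \<le> card I" using 3 fin card_mono[of I "{i, j}"] by simp
    ultimately show ?thesis by (simp add: weight_rank_def)
  qed
qed

lemma diagonal_weights_veronese_weights: "diagonal_weights (N + 2) (veronese_weights N)"
proof -
  have "vec.dim (veronese_weights N ` {..<N + 2}) = CARD(2)"
    using uniform_maximal_rank_veronese_weights[of N]
    by (simp add: uniform_maximal_rank_def weight_rank_def)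
  then show ?thesis
    unfolding diagonal_weights_def vec.dim_eq_full[symmetric] vec.dimension_def card_cart_basis .
qed

lemma poincare_domain_veronese_weights: "poincare_domain n (veronese_weights N)"
  unfolding poincare_domain_def
  by (rule exI[of _ "vector [1, 0]"]) (simp add: scalar_product_2 veronese_weights_nth)

section \<open>The envelope at the origin\<close>

text \<open>For empty support every vector is isotropic, in particular \<open>\<xi>\<close>. There
  the real part of a resonance is a sum of nonnegative terms, so each term vanishes.\<close>

lemma resonance_monoid_empty_poincare:
  fixes \<Lambda> :: "nat \<Rightarrow> complex ^ 'k"
  assumes "poincare_domain n \<Lambda>"
  shows "resonance_monoid n \<Lambda> {} = {0}"
proof -
  obtain \<xi> where \<xi>: "\<And>j. j < n \<Longrightarrow> 0 < Re (scalar_product (\<Lambda> j) \<xi>)"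
    using assms by (auto simp: poincare_domain_def)
  have "\<alpha> = 0" if "\<alpha> \<in> resonance_monoid n \<Lambda> {}" for \<alpha>
  proof (rule poly_mapping_eqI)
    fix j
    let ?r = "\<lambda>j. real (Poly_Mapping.lookup \<alpha> j) * Re (scalar_product (\<Lambda> j) \<xi>)"
    have "(\<Sum>j<n. of_nat (Poly_Mapping.lookup \<alpha> j) * scalar_product (\<Lambda> j) \<xi>) = 0"
      and keys: "Poly_Mapping.keys \<alpha> \<subseteq> {..<n}"
      using that by (auto simp: resonance_monoid_def isotropy_algebra_def)
    from arg_cong[OF this(1), of Re] have "(\<Sum>j<n. ?r j) = 0" by simp
    moreover have "0 \<le> ?r j" if "j < n" for j using \<xi>[OF that] by simp
    ultimately have r0: "?r j = 0" if "j < n" for j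
      using that sum_nonneg_eq_0_iff[of "{..<n}" ?r] by auto
    then have "Poly_Mapping.lookup \<alpha> j = 0" if "j < n" using r0[OF that] \<xi>[OF that] by simp
    moreover have "Poly_Mapping.lookup \<alpha> j = 0" if "\<not> j < n" using keys that by (auto simp: in_keys_iff)
    ultimately show "Poly_Mapping.lookup \<alpha> j = Poly_Mapping.lookup 0 j" by auto
  qed
  moreover have "0 \<in> resonance_monoid n \<Lambda> {}" by (simp add: resonance_monoid_def)
  ultimately show ?thesis by auto
qed

lemma spec_is_point_zero_monoid: "spec_is_point {0}"
  unfolding spec_is_point_def
proof (rule bij_betwI')
  show "(Poly_Mapping.single 0 c :: mpoly) = Poly_Mapping.single 0 d \<longleftrightarrow> c = d" for c d :: complex
    by (metis lookup_single_eq)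
next
  fix f assume "f \<in> carrier (monoid_algebra {0})"
  then have "Poly_Mapping.keys f \<subseteq> {0}" by (simp add: monoid_algebra_def)
  then have "f = Poly_Mapping.single 0 (Poly_Mapping.lookup f 0)"
    by (intro poly_mapping_eqI) (auto simp: lookup_single when_def in_keys_iff)
  then show "\<exists>c\<in>UNIV. f = Poly_Mapping.single 0 c" by blast
qed (simp add: monoid_algebra_def)

section \<open>The orbit on the first coordinate axis\<close>

text \<open>A nonzero functional is onto, so the velocities fill the whole line spanned by the
  point.\<close>

lemma orbit_dim_coordinate_axis:
  assumes "\<Lambda> 0 \<noteq> (0 :: complex ^ 2)"
  shows "orbit_dim \<Lambda> (\<lambda>j. if j = 0 then 1 else 0) = 1"
proof -
  interpret V: vector_space "\<lambda>(c::complex) v (j::nat). c * v j"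
    by unfold_locales (auto simp: fun_eq_iff algebra_simps)
  let ?z = "\<lambda>j::nat. if j = 0 then 1 else 0 :: complex"
  have "\<exists>t. scalar_product (\<Lambda> 0) t = c" for c
  proof (cases "\<Lambda> 0 $ 1 = 0")
    case True
    then have "\<Lambda> 0 $ 2 \<noteq> 0" using assms by (simp add: vec_eq_iff forall_2)
    then show ?thesis using True by (intro exI[of _ "vector [0, c / \<Lambda> 0 $ 2]"]) (simp add: scalar_product_2)
  next
    case False
    then show ?thesis by (intro exI[of _ "vector [c / \<Lambda> 0 $ 1, 0]"]) (simp add: scalar_product_2)
  qed
  then have "range (scalar_product (\<Lambda> 0)) = UNIV" by (metis surj_def)
  then have "orbit_tangent_space \<Lambda> ?z = (\<lambda>c j. c * ?z j) ` range (scalar_product (\<Lambda> 0))"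
    unfolding orbit_tangent_space_eq image_image by (intro image_cong) (auto simp: fun_eq_iff)
  also have "\<dots> = V.span {?z}"
    using \<open>range _ = UNIV\<close> by (simp add: V.span_singleton)
  finally have "orbit_dim \<Lambda> ?z = V.dim (V.span {?z})" by (simp add: orbit_dim_def)
  also have "?z \<noteq> 0" by (auto simp: fun_eq_iff intro!: exI[of _ 0])
  then have "V.dim (V.span {?z}) = 1"
    by (subst V.dim_span_eq_card_independent) simp_all
  finally show ?thesis .
qed

text \<open>Exponentials never vanish; hence the envelope is constant along an orbit.\<close>

lemma point_support_orbit: "w \<in> orbit \<Lambda> z \<Longrightarrow> point_support w = point_support z"
  by (auto simp: orbit_def act_def point_support_def)

text \<open>The last coordinate is redundant: it records half the degree, as forced by the weight \<open>(1, -2)\<close>.\<close>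

definition veronese :: "nat \<Rightarrow> (nat \<Rightarrow>\<^sub>0 nat) set" where
  "veronese N = {\<alpha>. Poly_Mapping.keys \<alpha> \<subseteq> {1..Suc N} \<and>
     (\<Sum>j=1..N. Poly_Mapping.lookup \<alpha> j) = 2 * Poly_Mapping.lookup \<alpha> (Suc N)}"

section \<open>Resonances along the axis and the dimension of the envelope\<close>

text \<open>On the isotropy algebra \<open>t $ 1 = 0\<close> each weight acts through its second
  coordinate, so the resonance sum is \<open>d * t $ 2\<close>; the vector \<open>(0, 1)\<close>
  detects \<open>d\<close>.\<close>

lemma resonance_monoid_veronese_weights:
  "resonance_monoid (N + 2) (veronese_weights N) {0} = veronese N"
proof -
  have set: "{..<N + 2} - {0} = {1..Suc N}" by auto
  have resonance: "(\<forall>t\<in>isotropy_algebra (veronese_weights N) {0}.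
      (\<Sum>j\<in>{1..Suc N}. of_nat (Poly_Mapping.lookup \<alpha> j) * scalar_product (veronese_weights N j) t) = 0) \<longleftrightarrow>
    (\<Sum>j=1..N. Poly_Mapping.lookup \<alpha> j) = 2 * Poly_Mapping.lookup \<alpha> (Suc N)" (is "?l \<longleftrightarrow> ?r") for \<alpha>
  proof -
    have iso: "isotropy_algebra (veronese_weights N) {0} = {t. t $ 1 = 0}"
      by (simp add: isotropy_algebra_def scalar_product_2 veronese_weights_nth)
    define d :: complex where
      "d = of_nat (\<Sum>j=1..N. Poly_Mapping.lookup \<alpha> j) - of_nat (2 * Poly_Mapping.lookup \<alpha> (Suc N))"
    have eq: "(\<Sum>j\<in>{1..Suc N}. of_nat (Poly_Mapping.lookup \<alpha> j) * scalar_product (veronese_weights N j) t) = d * t $ 2"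
      if "t $ 1 = 0" for t
    proof -
      have "(\<Sum>j=1..N. of_nat (Poly_Mapping.lookup \<alpha> j) * scalar_product (veronese_weights N j) t) =
          (\<Sum>j=1..N. of_nat (Poly_Mapping.lookup \<alpha> j) * t $ 2)"
        using that by (intro sum.cong) (auto simp: scalar_product_2 veronese_weights_nth)
      then show ?thesis
        using that by (simp add: scalar_product_2 veronese_weights_nth d_def algebra_simps flip: sum_distrib_left sum_distrib_right)
    qed
    have "?l \<longleftrightarrow> d = 0"
    proof
      assume ?l
      then show "d = 0" using eq[of "vector [0, 1]"] unfolding iso by auto
    next
      assume "d = 0"
      show ?l
      proof
        fix t assume "t \<in> isotropy_algebra (veronese_weights N) {0}"
        then have "t $ 1 = 0" by (simp add: iso)
        from eq[OF this] show "(\<Sum>j\<in>{1..Suc N}. of_nat (Poly_Mapping.lookup \<alpha> j) * scalar_product (veronese_weights N j) t) = 0"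
          unfolding \<open>d = 0\<close> mult_zero_left .
      qed
    qed
    also have "\<dots> \<longleftrightarrow> ?r" unfolding d_def right_minus_eq of_nat_eq_iff ..
    finally show ?thesis .
  qed
  show ?thesis unfolding resonance_monoid_def veronese_def set resonance ..
qed

text \<open>Supplies \<open>J_determines\<close> for \<open>J = {1..N}\<close>, whose
  \<open>N\<close> elements give the upper bound on the dimension.\<close>

lemma veronese_eqI:
  assumes "\<alpha> \<in> veronese N" "\<beta> \<in> veronese N"
    and "\<And>j. j \<in> {1..N} \<Longrightarrow> Poly_Mapping.lookup \<alpha> j = Poly_Mapping.lookup \<beta> j"
  shows "\<alpha> = \<beta>"
proof (rule poly_mapping_eqI)
  fix j
  have "(\<Sum>j=1..N. Poly_Mapping.lookup \<alpha> j) = (\<Sum>j=1..N. Poly_Mapping.lookup \<beta> j)"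
    using assms(3) by (rule sum.cong[OF refl])
  then have "Poly_Mapping.lookup \<alpha> (Suc N) = Poly_Mapping.lookup \<beta> (Suc N)"
    using assms(1,2) by (simp add: veronese_def)
  moreover consider "j \<in> {1..N}" | "j = Suc N" | "j \<notin> {1..Suc N}" by fastforce
  moreover have "Poly_Mapping.lookup \<alpha> j = 0" "Poly_Mapping.lookup \<beta> j = 0" if "j \<notin> {1..Suc N}"
    using that assms(1,2) unfolding veronese_def by (auto simp flip: not_in_keys_iff_lookup_eq_zero)
  ultimately show "Poly_Mapping.lookup \<alpha> j = Poly_Mapping.lookup \<beta> j"
    using assms(3) by metis
qed

interpretation veronese: exponent_monoid "veronese N" for N
proof
  show "0 \<in> veronese N" by (simp add: veronese_def)
  show "\<alpha> + \<beta> \<in> veronese N" if "\<alpha> \<in> veronese N" "\<beta> \<in> veronese N" for \<alpha> \<beta>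
    using that Poly_Mapping.keys_add[of \<alpha> \<beta>] by (auto simp: veronese_def lookup_add sum.distrib)
qed

text \<open>The exponent of the quadratic monomial in variables \<open>i\<close> and
  \<open>j\<close>, a square if \<open>i = j\<close>; the summand at \<open>Suc N\<close> is the
  forced half degree.\<close>

definition quadric_exponent :: "nat \<Rightarrow> nat \<Rightarrow> nat \<Rightarrow> (nat \<Rightarrow>\<^sub>0 nat)" where
  "quadric_exponent N i j = Poly_Mapping.single i 1 + Poly_Mapping.single j 1 + Poly_Mapping.single (Suc N) 1"

lemma lookup_quadric_exponent:
  "Poly_Mapping.lookup (quadric_exponent N i j) k = of_bool (i = k) + of_bool (j = k) + of_bool (k = Suc N)"
  by (auto simp: quadric_exponent_def lookup_add lookup_single when_def)

lemma quadric_exponent_in_veronese: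
  assumes "i \<in> {1..N}" "j \<in> {1..N}"
  shows "quadric_exponent N i j \<in> veronese N"
proof -
  have "(\<Sum>k=1..N. Poly_Mapping.lookup (quadric_exponent N i j) k) =
      (\<Sum>k=1..N. (if i = k then 1 else 0) + (if j = k then 1 else 0))"
    by (intro sum.cong) (auto simp: lookup_quadric_exponent)
  also have "\<dots> = 2" using assms by (simp add: sum.distrib)
  finally show ?thesis
    using assms by (auto simp: veronese_def lookup_quadric_exponent in_keys_iff split: if_splits)
qed

lemma krull_dim_veronese: "krull_dim (monoid_algebra (veronese N)) = enat N"
proof (rule antisym)
  show "krull_dim (monoid_algebra (veronese N)) \<le> enat N"
    using veronese.krull_dim_monoid_algebra_le[of "{1..N}" N] veronese_eqI by simp
  \<comment> \<open>A flag of faces: the first \<open>i\<close> coordinates vanish on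
    \<open>F i\<close>. The square of variable \<open>Suc i\<close> lies in \<open>F i\<close> but
    not in \<open>F (Suc i)\<close>, which makes the inclusions of primes strict.\<close>
  define F where "F = (\<lambda>i. {\<alpha> \<in> veronese N. \<forall>j\<in>{1..i}. Poly_Mapping.lookup \<alpha> j = 0})"
  define P where "P = (\<lambda>i. {f :: mpoly. Poly_Mapping.keys f \<subseteq> veronese N - F i})"
  show "enat N \<le> krull_dim (monoid_algebra (veronese N))"
  proof (rule krull_dim_geI)
    show "primeideal (P i) (monoid_algebra (veronese N))" for i
      unfolding P_def
    proof (rule veronese.primeideal_face)
      show "\<alpha> + \<beta> \<in> F i \<longleftrightarrow> \<alpha> \<in> F i \<and> \<beta> \<in> F i" if "\<alpha> \<in> veronese N" "\<beta> \<in> veronese N" for \<alpha> \<beta>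
        using that veronese.add_closed[OF that] by (auto simp: F_def lookup_add)
    qed (auto simp: F_def veronese.zero_closed)
    fix i assume i: "i < N"
    let ?q = "quadric_exponent N (Suc i) (Suc i)"
    have "?q \<in> veronese N" using i by (intro quadric_exponent_in_veronese) auto
    then have "?q \<in> F i" "?q \<in> veronese N - F (Suc i)"
      using i by (auto simp: F_def lookup_quadric_exponent intro!: bexI[of _ "Suc i"])
    then have "Poly_Mapping.single ?q 1 \<in> P (Suc i) - P i" by (auto simp: P_def)
    moreover have "F (Suc i) \<subseteq> F i" by (auto simp: F_def)
    then have "P i \<subseteq> P (Suc i)" by (auto simp: P_def)
    ultimately show "P i \<subset> P (Suc i)" by blast
  qed
qed

text \<open>The half degree is additive and equals one here, so one summand has half degree zero,
  hence degree zero.\<close>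

lemma indecomposable_quadric_exponent:
  assumes "i \<in> {1..N}" "j \<in> {1..N}"
  shows "veronese.indecomposable N (quadric_exponent N i j)"
  unfolding veronese.indecomposable_def
proof (intro conjI ballI impI)
  let ?q = "quadric_exponent N i j"
  have q: "Poly_Mapping.lookup ?q (Suc N) = 1" using assms by (auto simp: lookup_quadric_exponent)
  then show "?q \<noteq> 0" by auto
  fix \<beta> \<gamma> assume \<beta>\<gamma>: "\<beta> \<in> veronese N" "\<gamma> \<in> veronese N" "?q = \<beta> + \<gamma>"
  have zero: "\<delta> = 0" if "\<delta> \<in> veronese N" "Poly_Mapping.lookup \<delta> (Suc N) = 0" for \<delta>
    by (rule veronese_eqI[OF that(1) veronese.zero_closed]) (use that in \<open>auto simp: veronese_def\<close>)
  have "Poly_Mapping.lookup \<beta> (Suc N) + Poly_Mapping.lookup \<gamma> (Suc N) = 1"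
    using q \<beta>\<gamma>(3) by (simp add: lookup_add)
  then have "Poly_Mapping.lookup \<beta> (Suc N) = 0 \<or> Poly_Mapping.lookup \<gamma> (Suc N) = 0" by arith
  then show "\<beta> = 0 \<or> \<gamma> = 0" using zero \<beta>\<gamma>(1,2) by blast
qed (rule quadric_exponent_in_veronese[OF assms])

lemma singular_veronese:
  assumes "2 \<le> N"
  shows "singular_at_distinguished_point (veronese N)"
  unfolding singular_at_distinguished_point_def
proof (rule veronese.not_regular_local_ring)
  \<comment> \<open>The \<open>N\<close> products of variable \<open>1\<close> with each variable,
    together with the square of variable \<open>2\<close>, give \<open>N + 1\<close>
    indecomposables, one more than the dimension.\<close>
  let ?H = "insert (quadric_exponent N 2 2) (quadric_exponent N 1 ` {1..N})"
  show "finite ?H" by simp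
  show "veronese.indecomposable N \<alpha>" if "\<alpha> \<in> ?H" for \<alpha>
    using that assms by (auto intro!: indecomposable_quadric_exponent)
  have "inj_on (quadric_exponent N 1) {1..N}"
  proof (rule inj_onI)
    fix j k assume "quadric_exponent N 1 j = quadric_exponent N 1 k"
    then have "Poly_Mapping.lookup (quadric_exponent N 1 j) k = Poly_Mapping.lookup (quadric_exponent N 1 k) k"
      by simp
    then show "j = k" by (cases "j = k") (simp_all add: lookup_quadric_exponent)
  qed
  moreover have "quadric_exponent N 2 2 \<noteq> quadric_exponent N 1 j" for j
  proof
    assume "quadric_exponent N 2 2 = quadric_exponent N 1 j"
    then have "Poly_Mapping.lookup (quadric_exponent N 2 2) 1 = Poly_Mapping.lookup (quadric_exponent N 1 j) 1"
      by simp
    then show False using assms by (simp add: lookup_quadric_exponent)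
  qed
  ultimately have "card ?H = Suc N" by (subst card_insert_disjoint) (auto simp: card_image)
  then show "krull_dim (distinguished_local_ring (veronese N)) < enat (card ?H)"
    using veronese.krull_dim_local_ring_le[of N] by (auto simp: krull_dim_veronese elim: le_less_trans)
qed

section \<open>Both envelopes and the final assembly\<close>

text \<open>The supports \<open>{}\<close> and \<open>{0}\<close> have fewer than two elements, so
  the rank equals the cardinality and the smooth factor is trivial.\<close>

lemma envelope_veronese_weights:
  "transverse_envelope (N + 2) (veronese_weights N) (\<lambda>_. 0) = {0}"
  "transverse_envelope (N + 2) (veronese_weights N) (\<lambda>j. if j = 0 then 1 else 0) = veronese N"
proof -
  have rank: "weight_rank (veronese_weights N) I = min (card I) 2" if "I \<subseteq> {..<N + 2}" for I
    using uniform_maximal_rank_veronese_weights[of N] that by (simp add: uniform_maximal_rank_def)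
  have "envelope_monoid (N + 2) (veronese_weights N) I = resonance_monoid (N + 2) (veronese_weights N) I"
    if "I \<subseteq> {..<N + 2}" "card I < 2" for I
    using that rank[OF that(1)]
    by (intro envelope_monoid_eq_resonance_monoid uniform_maximal_rank_veronese_weights) auto
  then show "transverse_envelope (N + 2) (veronese_weights N) (\<lambda>_. 0) = {0}"
    "transverse_envelope (N + 2) (veronese_weights N) (\<lambda>j. if j = 0 then 1 else 0) = veronese N"
    by (simp_all add: transverse_envelope_def point_support_def resonance_monoid_veronese_weights[simplified]
      resonance_monoid_empty_poincare[OF poincare_domain_veronese_weights])
qed

lemma veronese_action:
  fixes N
  defines "n \<equiv> N + 2" and "\<Lambda> \<equiv> veronese_weights N" and "z \<equiv> \<lambda>j. if j = 0 then 1 else 0"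
  shows "diagonal_weights n \<Lambda>" "uniform_maximal_rank n \<Lambda>" "poincare_domain n \<Lambda>"
    "spec_is_point (transverse_envelope n \<Lambda> (\<lambda>_. 0))"
    "z \<in> affine_space n" "singular_orbit \<Lambda> z" "orbit_dim \<Lambda> z = 1"
    "w \<in> orbit \<Lambda> z \<Longrightarrow> spec_dim (transverse_envelope n \<Lambda> w) = enat N"
    "w \<in> orbit \<Lambda> z \<Longrightarrow> 2 \<le> N \<Longrightarrow> singular_at_distinguished_point (transverse_envelope n \<Lambda> w)"
proof -
  show "orbit_dim \<Lambda> z = 1"
    unfolding \<Lambda>_def z_def by (intro orbit_dim_coordinate_axis veronese_weights_nonzero)
  then show "singular_orbit \<Lambda> z" by (simp add: singular_orbit_def)
  have "transverse_envelope n \<Lambda> w = veronese N" if "w \<in> orbit \<Lambda> z"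
    using point_support_orbit[OF that] envelope_veronese_weights(2)[of N]
    by (simp add: transverse_envelope_def n_def \<Lambda>_def z_def)
  then show "w \<in> orbit \<Lambda> z \<Longrightarrow> spec_dim (transverse_envelope n \<Lambda> w) = enat N"
    "w \<in> orbit \<Lambda> z \<Longrightarrow> 2 \<le> N \<Longrightarrow> singular_at_distinguished_point (transverse_envelope n \<Lambda> w)"
    by (simp_all add: spec_dim_def krull_dim_veronese singular_veronese)
  show "diagonal_weights n \<Lambda>" "uniform_maximal_rank n \<Lambda>" "poincare_domain n \<Lambda>"
    unfolding n_def \<Lambda>_def
    by (rule diagonal_weights_veronese_weights uniform_maximal_rank_veronese_weights
        poincare_domain_veronese_weights)+
  show "spec_is_point (transverse_envelope n \<Lambda> (\<lambda>_. 0))"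
    unfolding n_def \<Lambda>_def envelope_veronese_weights by (rule spec_is_point_zero_monoid)
  show "z \<in> affine_space n" by (simp add: z_def n_def affine_space_def)
qed

theorem theorem4p6:
  shows "(\<forall>N::nat. N \<ge> 1 \<longrightarrow>
           (\<exists>(n::nat) (\<Lambda> :: nat \<Rightarrow> complex ^ 2).
              diagonal_weights n \<Lambda> \<and> uniform_maximal_rank n \<Lambda> \<and> poincare_domain n \<Lambda> \<and>
              spec_is_point (transverse_envelope n \<Lambda> (\<lambda>_. 0)) \<and>
              (\<exists>z \<in> affine_space n. singular_orbit \<Lambda> z \<and> orbit_dim \<Lambda> z = 1 \<and>
                 (\<forall>w \<in> orbit \<Lambda> z. spec_dim (transverse_envelope n \<Lambda> w) = enat N))))
       \<and> (\<forall>N::nat. N \<ge> 3 \<longrightarrow>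
           (\<exists>(n::nat) (\<Lambda> :: nat \<Rightarrow> complex ^ 2).
              diagonal_weights n \<Lambda> \<and> uniform_maximal_rank n \<Lambda> \<and> poincare_domain n \<Lambda> \<and>
              spec_is_point (transverse_envelope n \<Lambda> (\<lambda>_. 0)) \<and>
              (\<exists>z \<in> affine_space n. singular_orbit \<Lambda> z \<and> orbit_dim \<Lambda> z = 1 \<and>
                 (\<forall>w \<in> orbit \<Lambda> z. spec_dim (transverse_envelope n \<Lambda> w) = enat N \<and>
                    singular_at_distinguished_point (transverse_envelope n \<Lambda> w)))))"
proof (intro conjI allI impI)
  fix N :: nat
  note ex = veronese_action[where N = N]
  show "\<exists>n (\<Lambda> :: nat \<Rightarrow> complex ^ 2).
      diagonal_weights n \<Lambda> \<and> uniform_maximal_rank n \<Lambda> \<and> poincare_domain n \<Lambda> \<and>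
      spec_is_point (transverse_envelope n \<Lambda> (\<lambda>_. 0)) \<and>
      (\<exists>z \<in> affine_space n. singular_orbit \<Lambda> z \<and> orbit_dim \<Lambda> z = 1 \<and>
         (\<forall>w \<in> orbit \<Lambda> z. spec_dim (transverse_envelope n \<Lambda> w) = enat N))"
    by (rule exI[of _ "N + 2"], rule exI[of _ "veronese_weights N"])
      (intro conjI bexI[OF _ ex(5)] ballI ex)
  assume "3 \<le> N"
  then have "2 \<le> N" by simp
  show "\<exists>n (\<Lambda> :: nat \<Rightarrow> complex ^ 2).
      diagonal_weights n \<Lambda> \<and> uniform_maximal_rank n \<Lambda> \<and> poincare_domain n \<Lambda> \<and>
      spec_is_point (transverse_envelope n \<Lambda> (\<lambda>_. 0)) \<and>
      (\<exists>z \<in> affine_space n. singular_orbit \<Lambda> z \<and> orbit_dim \<Lambda> z = 1 \<and>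
         (\<forall>w \<in> orbit \<Lambda> z. spec_dim (transverse_envelope n \<Lambda> w) = enat N \<and>
            singular_at_distinguished_point (transverse_envelope n \<Lambda> w)))"
    by (rule exI[of _ "N + 2"], rule exI[of _ "veronese_weights N"])
      (intro conjI bexI[OF _ ex(5)] ballI ex \<open>2 \<le> N\<close>)
qed

end
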